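(* Let $\mathbf{X}=(X_n)_{n\ge 0}$ be a transient irreducible Markov chain, admitting a stationary measure, on a countable state space $V$. Let $\mathrm{PATH}$ be the random graph traced by $\mathbf{X}$, let $N(e)$ be the number of crossings of the undirected edge $e$ by $\mathbf X$, and let $G(\mathbf{X})$ be the undirected graph supporting the transitions of $\mathbf X$. Then the following hold: (i) The (random) graph $\mathrm{PATH}$ is a.s. recurrent for simple random walk. (ii) The random walk on the (random) network $(\mathrm{PATH},N)$ (in which the edge weight of an edge $e$ is $N(e)$) is a.s. recurrent. (iii) For every $o\in V$ the random walk on the network $(G(\mathbf{X}),\mathbb{E}_o[N])$ (in which the edge weight of an edge $e$ is $\mathbb{E}_o[N(e)]$) is recurrent.
   Context: Let $P$ be the transition kernel of $\mathbf X$; $\mathbf X$ is started from a fixed initial state. $\mathbb{E}_o$ denotes expectation for the chain started from $X_0=o$. The chain need not be reversible. A stationary measure is a measure $\pi$ on $V$ with $0<\pi(x)<\infty$ for all $x$ and $\pi P=\pi$ (its total mass may be infinite). The chain is recurrent if the initial state is visited infinitely often a.s., and transient otherwise. Graphs are undirected and may contain loops. $G(\mathbf{X})=(V,E)$ with $E:=\{\{u,v\}: P(u,v)+P(v,u)>0\}$; it need not be locally finite. $N(x,y)=N(y,x):=|\{n\ge 0:\{X_n,X_{n+1}\}=\{x,y\}\}|$. $\mathrm{PATH}$ is the graph with vertex set $\{X_n:n\ge 0\}$ and edge set $\{\{X_n,X_{n+1}\}:n\ge 0\}=\{e\in E:N(e)>0\}$. A network is a graph with symmetric edge weights $c_{u,v}=c_{v,u}\ge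 0$ (zero off the edge set) with $c_v:=\sum_w c_{v,w}<\infty$ for every vertex $v$; the associated random walk moves from $v$ to $u$ with probability $c_{u,v}/c_v$. Simple random walk is the walk with all edge weights equal to $1$. A connected graph or network is called recurrent if the corresponding walk is recurrent. *)

theory Defs
  imports "HOL-Probability.Probability"
begin

text \<open>
  The state space is a type of class \<open>countable\<close>, and a transition kernel \<open>P\<close> is given
  by the distributions \<open>K x = P(x, \<cdot>)\<close>, that is, \<open>P(x,y) = pmf (K x) y\<close>.
\<close>

definition markov_chain ::
    "'w measure \<Rightarrow> ('v::countable \<Rightarrow> 'v pmf) \<Rightarrow> 'v \<Rightarrow> (nat \<Rightarrow> 'w \<Rightarrow> 'v) \<Rightarrow> bool" where
  "markov_chain M K s X \<longleftrightarrow>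
     prob_space M \<and>
     (\<forall>n. X n \<in> M \<rightarrow>\<^sub>M count_space UNIV) \<and>
     (AE \<omega> in M. X 0 \<omega> = s) \<and>
     (\<forall>n x. measure M {\<omega> \<in> space M. \<forall>i\<le>Suc n. X i \<omega> = x i} =
            measure M {\<omega> \<in> space M. \<forall>i\<le>n. X i \<omega> = x i} * pmf (K (x n)) (x (Suc n)))"

definition step_law :: "('v \<Rightarrow> 'v pmf) \<Rightarrow> 'v \<Rightarrow> nat \<Rightarrow> (nat \<Rightarrow> 'v) \<Rightarrow> 'v measure" where
  "step_law K s n \<omega> =
     measure_pmf (case n of 0 \<Rightarrow> return_pmf s | Suc m \<Rightarrow> K (\<omega> m))"

text \<open>
  The law of the chain with kernel \<open>K\<close> started from \<open>s\<close>, as a measure on the space of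
  trajectories, obtained from the Ionescu-Tulcea theorem.
\<close>

definition chain_law :: "('v::countable \<Rightarrow> 'v pmf) \<Rightarrow> 'v \<Rightarrow> (nat \<Rightarrow> 'v) measure" where
  "chain_law K s =
     projective_family.lim UNIV (Ionescu_Tulcea.CI (step_law K s) (\<lambda>_. count_space UNIV))
       (\<lambda>_. count_space UNIV)"

definition recurrent_process :: "'w measure \<Rightarrow> (nat \<Rightarrow> 'w \<Rightarrow> 'v) \<Rightarrow> bool" where
  "recurrent_process M X \<longleftrightarrow> (AE \<omega> in M. \<exists>\<^sub>\<infinity>n. X n \<omega> = X 0 \<omega>)"

definition transient_process :: "'w measure \<Rightarrow> (nat \<Rightarrow> 'w \<Rightarrow> 'v) \<Rightarrow> bool" where
  "transient_process M X \<longleftrightarrow> \<not> recurrent_process M X"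

definition n_step :: "('v \<Rightarrow> 'v pmf) \<Rightarrow> nat \<Rightarrow> 'v \<Rightarrow> 'v pmf" where
  "n_step K n x = ((\<lambda>\<mu>. bind_pmf \<mu> K) ^^ n) (return_pmf x)"

definition irreducible_kernel :: "('v \<Rightarrow> 'v pmf) \<Rightarrow> bool" where
  "irreducible_kernel K \<longleftrightarrow> (\<forall>x y. \<exists>n. pmf (n_step K n x) y > 0)"

definition stationary_measure :: "('v \<Rightarrow> 'v pmf) \<Rightarrow> ('v \<Rightarrow> ennreal) \<Rightarrow> bool" where
  "stationary_measure K \<pi> \<longleftrightarrow>
     (\<forall>x. 0 < \<pi> x \<and> \<pi> x < \<infinity>) \<and>
     (\<forall>y. (\<integral>\<^sup>+ x. \<pi> x * ennreal (pmf (K x) y) \<partial>count_space UNIV) = \<pi> y)"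

text \<open>An edge is a set \<open>{u, v}\<close>; a loop is a singleton.\<close>

record 'v ugraph =
  vertices :: "'v set"
  edges :: "'v set set"

definition wf_ugraph :: "'v ugraph \<Rightarrow> bool" where
  "wf_ugraph G \<longleftrightarrow> edges G \<subseteq> {{u, v} | u v. u \<in> vertices G \<and> v \<in> vertices G}"

definition connected_ugraph :: "'v ugraph \<Rightarrow> bool" where
  "connected_ugraph G \<longleftrightarrow>
     (\<forall>u\<in>vertices G. \<forall>v\<in>vertices G. (u, v) \<in> {(x, y). {x, y} \<in> edges G}\<^sup>*)"

text \<open>
  Edge weights are taken in \<open>ennreal\<close>, since crossing counts and their expectations are a
  priori possibly infinite; finiteness is part of \<open>network\<close>. A loop contributes its
  weight once to the total weight of its vertex.
\<close>

definition vertex_weight :: "('v \<Rightarrow> 'v \<Rightarrow> ennreal) \<Rightarrow> 'v \<Rightarrow> ennreal" where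
  "vertex_weight c v = (\<integral>\<^sup>+ w. c v w \<partial>count_space UNIV)"

definition network :: "'v ugraph \<Rightarrow> ('v \<Rightarrow> 'v \<Rightarrow> ennreal) \<Rightarrow> bool" where
  "network G c \<longleftrightarrow>
     wf_ugraph G \<and>
     (\<forall>u v. c u v = c v u) \<and>
     (\<forall>u v. {u, v} \<notin> edges G \<longrightarrow> c u v = 0) \<and>
     (\<forall>v\<in>vertices G. vertex_weight c v < \<infinity>)"

text \<open>Meaningful at vertices \<open>v\<close> with \<open>0 < vertex_weight c v < \<infinity>\<close> only.\<close>

definition walk_kernel :: "('v \<Rightarrow> 'v \<Rightarrow> ennreal) \<Rightarrow> 'v \<Rightarrow> 'v pmf" where
  "walk_kernel c v = embed_pmf (\<lambda>u. enn2real (c v u / vertex_weight c v))"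

text \<open>
  Recurrence includes that \<open>(G, c)\<close> is a connected network on which the random walk is
  well defined (\<open>vertex_weight c v > 0\<close>), and is required from every starting vertex.
\<close>

definition recurrent_network :: "'v::countable ugraph \<Rightarrow> ('v \<Rightarrow> 'v \<Rightarrow> ennreal) \<Rightarrow> bool" where
  "recurrent_network G c \<longleftrightarrow>
     network G c \<and> connected_ugraph G \<and>
     (\<forall>v\<in>vertices G. 0 < vertex_weight c v \<and>
        recurrent_process (chain_law (walk_kernel c) v) (\<lambda>n \<omega>. \<omega> n))"

definition recurrent_graph :: "'v::countable ugraph \<Rightarrow> bool" where
  "recurrent_graph G \<longleftrightarrow> recurrent_network G (\<lambda>u v. if {u, v} \<in> edges G then 1 else 0)"

definition transition_graph :: "('v \<Rightarrow> 'v pmf) \<Rightarrow> 'v ugraph" where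
  "transition_graph K =
     \<lparr>vertices = UNIV, edges = {{u, v} | u v. pmf (K u) v + pmf (K v) u > 0}\<rparr>"

definition path_graph :: "(nat \<Rightarrow> 'v) \<Rightarrow> 'v ugraph" where
  "path_graph x = \<lparr>vertices = range x, edges = {{x n, x (Suc n)} | n. True}\<rparr>"

definition crossings :: "(nat \<Rightarrow> 'v) \<Rightarrow> 'v \<Rightarrow> 'v \<Rightarrow> ennreal" where
  "crossings x u v = emeasure (count_space UNIV) {n. {x n, x (Suc n)} = {u, v}}"

definition expected_crossings ::
    "('v::countable \<Rightarrow> 'v pmf) \<Rightarrow> 'v \<Rightarrow> 'v \<Rightarrow> 'v \<Rightarrow> ennreal" where
  "expected_crossings K z u v = (\<integral>\<^sup>+ \<omega>. crossings \<omega> u v \<partial>chain_law K z)"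

lemma pmf_walk_kernel:
  assumes "0 < vertex_weight c v" "vertex_weight c v < \<infinity>"
  shows "pmf (walk_kernel c v) u = enn2real (c v u / vertex_weight c v)"
  unfolding walk_kernel_def
proof (rule pmf_embed_pmf)
  have le: "c v u \<le> vertex_weight c v" for u
    unfolding vertex_weight_def by (rule nn_integral_ge_point) simp
  have fin: "c v u / vertex_weight c v < \<infinity>" for u
    using le[of u] assms by (auto simp: ennreal_divide_eq_top_iff less_top[symmetric] top_unique)
  have "(\<integral>\<^sup>+u. ennreal (enn2real (c v u / vertex_weight c v)) \<partial>count_space UNIV) =
      (\<integral>\<^sup>+u. c v u / vertex_weight c v \<partial>count_space UNIV)"
    using fin by (intro nn_integral_cong) simp
  also have "\<dots> = vertex_weight c v / vertex_weight c v"
    by (simp add: nn_integral_divide vertex_weight_def)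
  also have "\<dots> = 1"
    using assms by (simp add: ennreal_divide_self)
  finally show "(\<integral>\<^sup>+u. ennreal (enn2real (c v u / vertex_weight c v)) \<partial>count_space UNIV) = 1" .
qed simp

lemma Ionescu_Tulcea_step_law:
  "Ionescu_Tulcea (step_law K s) (\<lambda>_. count_space (UNIV :: 'v::countable set))"
proof (rule Ionescu_Tulcea.intro)
  fix i
  show "step_law K s i \<in> PiM {0..<i} (\<lambda>_. count_space UNIV) \<rightarrow>\<^sub>M subprob_algebra (count_space UNIV)"
  proof (cases i)
    case 0
    then show ?thesis
      by (auto simp: step_law_def[abs_def] measure_pmf_in_subprob_algebra)
  next
    case (Suc m)
    have "(\<lambda>\<omega>. \<omega> m) \<in> PiM {0..<i} (\<lambda>_. count_space (UNIV :: 'v set)) \<rightarrow>\<^sub>M count_space UNIV"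
      using Suc by (intro measurable_component_singleton) auto
    moreover have "(\<lambda>x. measure_pmf (K x)) \<in> count_space UNIV \<rightarrow>\<^sub>M subprob_algebra (count_space UNIV)"
      by (simp add: measure_pmf_in_subprob_algebra)
    ultimately have "(\<lambda>\<omega>. measure_pmf (K (\<omega> m))) \<in>
        PiM {0..<i} (\<lambda>_. count_space UNIV) \<rightarrow>\<^sub>M subprob_algebra (count_space UNIV)"
      by (rule measurable_compose)
    then show ?thesis
      by (simp add: Suc step_law_def[abs_def])
  qed
next
  show "prob_space (step_law K s i x)" for i x
    by (simp add: step_law_def measure_pmf.prob_space_axioms)
qed

lemma markov_chain_chain_law:
  fixes K :: "'v::countable \<Rightarrow> 'v pmf"
  shows "markov_chain (chain_law K s) K s (\<lambda>n \<omega>. \<omega> n)"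
proof -
  let ?C = "\<lambda>_::nat. count_space (UNIV :: 'v set)"
  interpret I: Ionescu_Tulcea "step_law K s" ?C
    by (rule Ionescu_Tulcea_step_law)
  have law: "chain_law K s = I.PF.lim"
    by (simp add: chain_law_def)
  have sets_law: "sets (chain_law K s) = sets (PiM UNIV ?C)"
    by (simp add: law)
  have space_law: "space (chain_law K s) = UNIV"
    by (simp add: law space_PiM)
  define S where "S n x = {restrict x {0..<n}}" for n and x :: "nat \<Rightarrow> 'v"
  have S_sets: "S n x \<in> sets (PiM {0..<n} ?C)" for n x
  proof -
    have "S n x = PiE {0..<n} (\<lambda>i. {x i})"
      by (auto simp: S_def fun_eq_iff PiE_iff extensional_def)
    also have "\<dots> \<in> sets (PiM {0..<n} ?C)"
      by (intro sets_PiM_I_finite) auto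
    finally show ?thesis .
  qed
  have emb: "prod_emb UNIV ?C {0..<n} (S n x) = {\<omega>. \<forall>i<n. \<omega> i = x i}" for n x
    by (auto simp: prod_emb_def S_def restrict_def fun_eq_iff space_PiM) metis
  have cyl: "emeasure (chain_law K s) {\<omega>. \<forall>i<n. \<omega> i = x i} =
      emeasure (I.C 0 n (\<lambda>_. undefined)) (S n x)" for n x
  proof -
    have "emeasure (chain_law K s) {\<omega>. \<forall>i<n. \<omega> i = x i} = emeasure (I.CI {0..<n}) (S n x)"
      unfolding law emb[symmetric] by (rule I.lim) (auto simp: S_sets)
    also have "\<dots> = emeasure (I.C 0 n (\<lambda>_. undefined)) (prod_emb {0..<n} ?C {0..<n} (S n x))"
      by (rule I.emeasure_CI) (auto simp: S_sets)
    also have "prod_emb {0..<n} ?C {0..<n} (S n x) = S n x"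
      by (rule prod_emb_id) (auto simp: S_def PiE_iff)
    finally show ?thesis .
  qed
  have undef: "(\<lambda>_. undefined) \<in> space (PiM {0..<0} ?C)"
    by (simp add: space_PiM)
  have C_Suc: "emeasure (I.C 0 (Suc n) (\<lambda>_. undefined)) (S (Suc n) x) =
      emeasure (I.C 0 n (\<lambda>_. undefined)) (S n x) * emeasure (step_law K s n x) {x n}" for n x
  proof -
    let ?Cn = "I.C 0 n (\<lambda>_. undefined)"
    have sets_Cn: "sets ?Cn = sets (PiM {0..<n} ?C)"
      using I.sets_C[OF undef, of n] by simp
    have space_Cn: "space ?Cn = space (PiM {0..<n} ?C)"
      using I.space_C[OF undef, of n] by simp
    have eP: "emeasure (I.eP n \<omega>) (S (Suc n) x) =
        emeasure (step_law K s n x) {x n} * indicator (S n x) \<omega>"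
      if "\<omega> \<in> space (PiM {0..<n} ?C)" for \<omega>
    proof -
      have ext: "\<omega> \<in> extensional {0..<n}"
        using that by (simp add: space_PiM PiE_def)
      have "fun_upd \<omega> n y \<in> S (Suc n) x \<longleftrightarrow> \<omega> \<in> S n x \<and> y = x n" for y
      proof
        assume "fun_upd \<omega> n y \<in> S (Suc n) x"
        then have *: "fun_upd \<omega> n y = restrict x {0..<Suc n}" by (simp add: S_def)
        have "\<omega> i = restrict x {0..<n} i" for i
          using fun_cong[OF *, of i] ext by (auto simp: extensional_def split: if_splits)
        moreover have "y = x n" using fun_cong[OF *, of n] by simp
        ultimately show "\<omega> \<in> S n x \<and> y = x n" by (auto simp: S_def)
      next
        assume "\<omega> \<in> S n x \<and> y = x n"
        then show "fun_upd \<omega> n y \<in> S (Suc n) x"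
          by (auto simp: S_def fun_eq_iff)
      qed
      then have "fun_upd \<omega> n -` S (Suc n) x \<inter> space (count_space UNIV) =
          (if \<omega> \<in> S n x then {x n} else {})"
        by auto
      moreover have "step_law K s n \<omega> = step_law K s n x" if "\<omega> \<in> S n x"
        using that by (cases n) (auto simp: S_def step_law_def)
      ultimately show ?thesis
        by (simp add: I.emeasure_eP[OF that S_sets])
    qed
    have "emeasure (I.C 0 (Suc n) (\<lambda>_. undefined)) (S (Suc n) x) =
        (\<integral>\<^sup>+\<omega>. emeasure (I.eP n \<omega>) (S (Suc n) x) \<partial>?Cn)"
      unfolding I.C.simps add_0
    proof (rule emeasure_bind)
      show "space ?Cn \<noteq> {}"
        using I.prob_space_C[OF undef, of n] by (rule prob_space.not_empty)
      show "I.eP n \<in> ?Cn \<rightarrow>\<^sub>M subprob_algebra (PiM {0..<Suc n} ?C)"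
        using I.measurable_eP[of n] by (simp add: measurable_cong_sets[OF sets_Cn refl])
    qed (rule S_sets)
    also have "\<dots> = (\<integral>\<^sup>+\<omega>. emeasure (step_law K s n x) {x n} * indicator (S n x) \<omega> \<partial>?Cn)"
      by (intro nn_integral_cong eP) (simp add: space_Cn)
    also have "\<dots> = emeasure (step_law K s n x) {x n} * emeasure ?Cn (S n x)"
      by (rule nn_integral_cmult_indicator) (simp add: sets_Cn S_sets)
    finally show ?thesis
      by (simp add: mult.commute)
  qed
  have prob: "prob_space (chain_law K s)"
    unfolding law
  proof
    have "{\<omega>::nat \<Rightarrow> 'v. \<forall>i<0. \<omega> i = x i} = UNIV" for x :: "nat \<Rightarrow> 'v"
      by simp
    then show "emeasure I.PF.lim (space I.PF.lim) = 1"
      using cyl[of 0] by (simp add: law[symmetric] space_law S_def restrict_def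
        emeasure_return[OF S_sets[of 0, unfolded S_def]] PiM_empty)
  qed
  interpret P: prob_space "chain_law K s" by (rule prob)
  have meas: "(\<lambda>\<omega>. \<omega> n) \<in> chain_law K s \<rightarrow>\<^sub>M count_space UNIV" for n
    using measurable_component_singleton[of n UNIV ?C]
    by (simp add: measurable_cong_sets[OF sets_law refl])
  have step: "emeasure (chain_law K s) {\<omega>. \<forall>i<Suc n. \<omega> i = x i} =
     emeasure (chain_law K s) {\<omega>. \<forall>i<n. \<omega> i = x i} * emeasure (step_law K s n x) {x n}" for n x
    unfolding cyl by (rule C_Suc)
  show ?thesis
    unfolding markov_chain_def space_law
  proof (intro conjI allI prob meas)
    have "emeasure (chain_law K s) {\<omega>. \<omega> 0 = s} = 1"
      using step[of 0 "\<lambda>_. s"] P.emeasure_space_1 by (simp add: step_law_def space_law)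
    moreover have "{\<omega>. \<omega> 0 = s} \<in> sets (chain_law K s)"
      using measurable_sets[OF meas[of 0], of "{s}"] by (simp add: space_law vimage_def)
    ultimately show "AE \<omega> in chain_law K s. \<omega> 0 = s"
      using P.prob_Collect_eq_1[of "\<lambda>\<omega>. \<omega> 0 = s"] by (simp add: space_law measure_def)
  next
    fix n x
    show "measure (chain_law K s) {\<omega> \<in> UNIV. \<forall>i\<le>Suc n. \<omega> i = x i} =
        measure (chain_law K s) {\<omega> \<in> UNIV. \<forall>i\<le>n. \<omega> i = x i} * pmf (K (x n)) (x (Suc n))"
      using step[of "Suc n" x]
      by (simp add: step_law_def emeasure_pmf_single measure_def enn2real_mult less_Suc_eq_le)
  qed
qed

end

theory Submission
  imports Defs
begin

text \<open>
  Let \<open>g(x)\<close> be the expected number of visits to \<open>x\<close> by the chain started from \<open>z\<close>, let \<open>\<pi>\<close> be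
  stationary, \<open>c(x,y) = \<pi>(x) P(x,y)\<close> and \<open>v = g / \<pi>\<close>. A directed edge is crossed
  \<open>g(x) P(x,y) = v(x) c(x,y)\<close> times on average, and the equation \<open>g = \<delta>\<^sub>z + gP\<close> says that \<open>v\<close> is
  harmonic off \<open>z\<close> for the time reversal of the chain. The role of reversibility is taken by the equality of
  the row sums and the column sums of \<open>c\<close>, which are both \<open>\<pi>\<close>.

  The heart of the matter is that the truncations \<open>f\<^sub>a = min(v, a) / a\<close> have bounded energy in the
  network of crossings, uniformly in \<open>a > 0\<close>. Pairing the equation of \<open>v\<close> with \<open>\<phi>(v)\<close>, and using that
  the sums of \<open>c(x,y) \<Phi>(v(x))\<close> and of \<open>c(x,y) \<Phi>(v(y))\<close> agree for a primitive \<open>\<Phi>\<close> of \<open>\<phi>\<close>, yields the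
  identity (\<open>bregman_energy\<close>)
    \<open>\<Sum> c(x,y) (\<Phi>(v(x)) - \<Phi>(v(y)) - \<phi>(v(y)) (v(x) - v(y))) = \<phi>(v(z))\<close>.
  For \<open>\<phi>(t) = min(t, a)\<close> the bracket dominates \<open>v(x) (\<phi>(v(x)) - \<phi>(v(y)))\<^sup>2 / (2a)\<close>, also across edges on
  which \<open>v\<close> drops from far above \<open>a\<close> to far below it, and so \<open>f\<^sub>a\<close> has energy at most 2.

  As \<open>a\<close> tends to 0, \<open>f\<^sub>a\<close> tends to 1 pointwise, so the gradients of the \<open>f\<^sub>a\<close> are bounded in \<open>L\<^sup>2\<close> and
  tend to 0 pointwise. By a Mazur-type lemma, convex combinations of them tend to 0 in norm. For fixed \<open>a\<close>,
  the Green functions killed outside finite sets play the same role: they give finitely supported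
  functions with bounded energy (the bound depends on \<open>a\<close>) that converge pointwise to \<open>f\<^sub>a\<close>. Together,
  there are finitely supported functions with value 1 at a prescribed vertex and arbitrarily small energy in the
  network of expected crossings (\<open>vanishing_capacity_of_crossing_weights\<close>). By the classical capacity criterion
  (\<open>green_infinite_if_vanishing_capacity\<close>) the random walk on that network is recurrent.

  The statement on the random network follows from the expected one. Choose test functions \<open>F\<^sub>m\<close> of expected energy at
  most \<open>2\<^sup>-\<^sup>m\<close>. By Fubini the energies of the \<open>F\<^sub>m\<close> with respect to the actual crossing numbers have a
  finite expected sum, so almost surely they tend to 0, and the same capacity criterion applies to the random network
  (\<open>AE_vanishing_capacity_crossings\<close>). Since every edge of the trace is crossed at least once, replacing all
  crossing numbers by 1 only lowers energies, which gives the simple random walk.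
\<close>

section \<open>Convex sets in L2 and pointwise limits\<close>

definition l2_closure :: "'a measure \<Rightarrow> ('a \<Rightarrow> real) set \<Rightarrow> ('a \<Rightarrow> real) set" where
  "l2_closure M C = {f \<in> borel_measurable M.
     \<forall>e>0. \<exists>g\<in>C. (\<integral>\<^sup>+x. ennreal ((f x - g x)\<^sup>2) \<partial>M) < e}"

definition convex_functions :: "('a \<Rightarrow> real) set \<Rightarrow> bool" where
  "convex_functions C \<longleftrightarrow>
     (\<forall>f\<in>C. \<forall>g\<in>C. \<forall>t. 0 \<le> t \<longrightarrow> t \<le> 1 \<longrightarrow> (\<lambda>x. (1 - t) * f x + t * g x) \<in> C)"

text \<open>
  Bounded and pointwise null sequences are weakly null. The factor \<open>\<bar>g\<bar>\<close> is split at the height \<open>K \<bar>F\<bar>\<close>: the part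
  below is dominated by \<open>K F\<^sup>2\<close>, and the part above contributes at most \<open>g\<^sup>2 / K\<close>, which is uniformly small
  in mean for large \<open>K\<close>.
\<close>

lemma l2_pairing_tendsto_0:
  fixes F :: "'a \<Rightarrow> real" and g :: "nat \<Rightarrow> 'a \<Rightarrow> real"
  assumes [measurable]: "F \<in> borel_measurable M" "\<And>n. g n \<in> borel_measurable M"
    and F: "(\<integral>\<^sup>+x. ennreal ((F x)\<^sup>2) \<partial>M) < \<infinity>"
    and g: "\<And>n. (\<integral>\<^sup>+x. ennreal ((g n x)\<^sup>2) \<partial>M) \<le> ennreal b" and b: "0 \<le> b"
    and lim: "AE x in M. (\<lambda>n. g n x) \<longlonglongrightarrow> 0"
  shows "(\<lambda>n. \<integral>\<^sup>+x. ennreal \<bar>F x * g n x\<bar> \<partial>M) \<longlonglongrightarrow> 0"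
proof (rule order_tendstoI)
  fix e :: ennreal assume "0 < e"
  then obtain d :: ennreal where d: "0 < d" "d < e" using dense by blast
  then obtain r :: real where r: "d = ennreal r" "0 < r"
    by (cases d) (auto simp: top_unique less_top[symmetric])
  define K where "K = 2 * b / r + 1"
  have K: "0 < K" "b / K < r / 2"
    using b r by (auto simp: K_def field_simps intro: add_nonneg_pos)
  have "(\<lambda>n. \<integral>\<^sup>+x. ennreal (\<bar>F x\<bar> * min \<bar>g n x\<bar> (K * \<bar>F x\<bar>)) \<partial>M) \<longlonglongrightarrow>
      (\<integral>\<^sup>+x. 0 \<partial>M)"
  proof (rule nn_integral_dominated_convergence[where w = "\<lambda>x. ennreal K * ennreal ((F x)\<^sup>2)"])
    show "(\<integral>\<^sup>+x. ennreal K * ennreal ((F x)\<^sup>2) \<partial>M) < \<infinity>"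
      using F by (simp add: nn_integral_cmult ennreal_mult_less_top)
    show "AE x in M. ennreal (\<bar>F x\<bar> * min \<bar>g n x\<bar> (K * \<bar>F x\<bar>)) \<le> ennreal K * ennreal ((F x)\<^sup>2)" for n
    proof (rule AE_I2)
      fix x
      have "\<bar>F x\<bar> * min \<bar>g n x\<bar> (K * \<bar>F x\<bar>) \<le> \<bar>F x\<bar> * (K * \<bar>F x\<bar>)"
        by (intro mult_left_mono) auto
      also have "\<dots> = K * (F x)\<^sup>2"
        by (simp add: power2_eq_square)
      finally show "ennreal (\<bar>F x\<bar> * min \<bar>g n x\<bar> (K * \<bar>F x\<bar>)) \<le> ennreal K * ennreal ((F x)\<^sup>2)"
        using K by (simp add: ennreal_mult[symmetric] ennreal_leI)
    qed
    show "AE x in M. (\<lambda>n. ennreal (\<bar>F x\<bar> * min \<bar>g n x\<bar> (K * \<bar>F x\<bar>))) \<longlonglongrightarrow> 0"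
      using lim
    proof eventually_elim
      case (elim x)
      have "(\<lambda>n. \<bar>F x\<bar> * min \<bar>g n x\<bar> (K * \<bar>F x\<bar>)) \<longlonglongrightarrow> \<bar>F x\<bar> * min \<bar>0\<bar> (K * \<bar>F x\<bar>)"
        by (intro tendsto_intros elim)
      also have "\<bar>F x\<bar> * min \<bar>0\<bar> (K * \<bar>F x\<bar>) = 0"
        using K by (simp add: min_def)
      finally show ?case
        by (metis ennreal_0 tendsto_ennrealI)
    qed
  qed auto
  then have "eventually (\<lambda>n. (\<integral>\<^sup>+x. ennreal (\<bar>F x\<bar> * min \<bar>g n x\<bar> (K * \<bar>F x\<bar>)) \<partial>M) < ennreal (r / 2))
      sequentially"
    using r by (intro order_tendstoD(2)) auto
  then show "eventually (\<lambda>n. (\<integral>\<^sup>+x. ennreal \<bar>F x * g n x\<bar> \<partial>M) < e) sequentially"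
  proof eventually_elim
    case (elim n)
    have pt: "\<bar>F x * g n x\<bar> \<le> \<bar>F x\<bar> * min \<bar>g n x\<bar> (K * \<bar>F x\<bar>) + (g n x)\<^sup>2 / K" for x
    proof (cases "\<bar>g n x\<bar> \<le> K * \<bar>F x\<bar>")
      case True
      then show ?thesis using K by (simp add: abs_mult)
    next
      case False
      then have "\<bar>F x\<bar> * \<bar>g n x\<bar> \<le> (\<bar>g n x\<bar> / K) * \<bar>g n x\<bar>"
        using K by (intro mult_right_mono) (auto simp: field_simps)
      also have "\<dots> = (g n x)\<^sup>2 / K" by (simp add: power2_eq_square)
      finally show ?thesis using False K by (simp add: abs_mult add_increasing)
    qed
    have "(\<integral>\<^sup>+x. ennreal \<bar>F x * g n x\<bar> \<partial>M) \<le>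
        (\<integral>\<^sup>+x. ennreal (\<bar>F x\<bar> * min \<bar>g n x\<bar> (K * \<bar>F x\<bar>)) + ennreal (1 / K) * ennreal ((g n x)\<^sup>2) \<partial>M)"
      using K pt by (intro nn_integral_mono)
        (auto simp: ennreal_mult[symmetric] ennreal_plus[symmetric] simp del: ennreal_plus intro!: ennreal_leI)
    also have "\<dots> = (\<integral>\<^sup>+x. ennreal (\<bar>F x\<bar> * min \<bar>g n x\<bar> (K * \<bar>F x\<bar>)) \<partial>M) +
        ennreal (1 / K) * (\<integral>\<^sup>+x. ennreal ((g n x)\<^sup>2) \<partial>M)"
      by (simp add: nn_integral_add nn_integral_cmult)
    also have "\<dots> \<le> ennreal (r / 2) + ennreal (1 / K) * ennreal b"
      using elim g[of n] by (intro add_mono mult_left_mono) auto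
    also have "\<dots> = ennreal (r / 2 + b / K)"
      using K b r by (simp add: ennreal_mult[symmetric])
    also have "\<dots> \<le> d"
      using K(2) unfolding r(1) by (intro ennreal_leI) linarith
    finally show ?case using d by simp
  qed
qed simp

lemma l2_norm_convex_comb_le:
  fixes F g :: "'a \<Rightarrow> real"
  assumes [measurable]: "F \<in> borel_measurable M" "g \<in> borel_measurable M" and t: "0 \<le> t" "t \<le> 1"
  shows "(\<integral>\<^sup>+x. ennreal (((1 - t) * F x + t * g x)\<^sup>2) \<partial>M) \<le>
    ennreal ((1 - t)\<^sup>2) * (\<integral>\<^sup>+x. ennreal ((F x)\<^sup>2) \<partial>M) + 2 * (\<integral>\<^sup>+x. ennreal \<bar>F x * g x\<bar> \<partial>M)
      + ennreal (t\<^sup>2) * (\<integral>\<^sup>+x. ennreal ((g x)\<^sup>2) \<partial>M)"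
proof -
  have pt: "((1 - t) * F x + t * g x)\<^sup>2 \<le> (1 - t)\<^sup>2 * (F x)\<^sup>2 + 2 * \<bar>F x * g x\<bar> + t\<^sup>2 * (g x)\<^sup>2" for x
  proof -
    have "(t * (1 - t)) * (F x * g x) \<le> \<bar>(t * (1 - t)) * (F x * g x)\<bar>" by simp
    also have "\<dots> = (t * (1 - t)) * \<bar>F x * g x\<bar>"
      using t by (simp add: abs_mult)
    also have "\<dots> \<le> 1 * \<bar>F x * g x\<bar>"
      using t by (intro mult_right_mono mult_le_one) auto
    finally have "2 * ((1 - t) * F x * (t * g x)) \<le> 2 * \<bar>F x * g x\<bar>"
      by (simp only: mult_ac mult_1) 
    then show ?thesis
      by (simp only: power2_sum power_mult_distrib mult.assoc)
  qed
  have "(\<integral>\<^sup>+x. ennreal (((1 - t) * F x + t * g x)\<^sup>2) \<partial>M) \<le>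
    (\<integral>\<^sup>+x. ennreal ((1 - t)\<^sup>2) * ennreal ((F x)\<^sup>2) + 2 * ennreal \<bar>F x * g x\<bar> + ennreal (t\<^sup>2) * ennreal ((g x)\<^sup>2) \<partial>M)"
  proof (intro nn_integral_mono)
    fix x
    have "ennreal (((1 - t) * F x + t * g x)\<^sup>2) \<le> ennreal ((1 - t)\<^sup>2 * (F x)\<^sup>2 + 2 * \<bar>F x * g x\<bar> + t\<^sup>2 * (g x)\<^sup>2)"
      by (intro ennreal_leI pt)
    also have "\<dots> = ennreal ((1 - t)\<^sup>2) * ennreal ((F x)\<^sup>2) + 2 * ennreal \<bar>F x * g x\<bar> + ennreal (t\<^sup>2) * ennreal ((g x)\<^sup>2)"
      using t by (simp add: ennreal_mult)
    finally show "ennreal (((1 - t) * F x + t * g x)\<^sup>2) \<le> \<dots>" .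
  qed
  also have "\<dots> = ennreal ((1 - t)\<^sup>2) * (\<integral>\<^sup>+x. ennreal ((F x)\<^sup>2) \<partial>M) + 2 * (\<integral>\<^sup>+x. ennreal \<bar>F x * g x\<bar> \<partial>M)
      + ennreal (t\<^sup>2) * (\<integral>\<^sup>+x. ennreal ((g x)\<^sup>2) \<partial>M)"
    by (simp add: nn_integral_add nn_integral_cmult)
  finally show ?thesis .
qed

text \<open>
  If \<open>F\<close> almost minimises the norm over \<open>C\<close>, then moving from \<open>F\<close> towards \<open>g n\<close> by a small step \<open>t\<close> decreases the
  squared norm \<open>D\<close> by about \<open>2 t D\<close>, at a cost of order \<open>t\<^sup>2\<close>, because the mixed term vanishes in the limit. Hence
  \<open>D = 0\<close>.
\<close>

lemma mazur_at_0:
  fixes C :: "('a \<Rightarrow> real) set" and g :: "nat \<Rightarrow> 'a \<Rightarrow> real"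
  assumes cvx: "convex_functions C" and meas: "\<And>f. f \<in> C \<Longrightarrow> f \<in> borel_measurable M"
    and gC: "\<And>n. g n \<in> C"
    and g: "\<And>n. (\<integral>\<^sup>+x. ennreal ((g n x)\<^sup>2) \<partial>M) \<le> ennreal b" and b: "0 \<le> b"
    and lim: "AE x in M. (\<lambda>n. g n x) \<longlonglongrightarrow> 0"
  shows "(INF f\<in>C. \<integral>\<^sup>+x. ennreal ((f x)\<^sup>2) \<partial>M) = 0"
proof -
  let ?N = "\<lambda>f. \<integral>\<^sup>+x. ennreal ((f x)\<^sup>2) \<partial>M"
  define D where "D = (INF f\<in>C. ?N f)"
  have D_le: "D \<le> ?N f" if "f \<in> C" for f
    unfolding D_def using that by (intro INF_lower)
  have "D \<le> ennreal b" using D_le[OF gC[of 0]] g[of 0] by (rule order_trans)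
  then obtain d where d: "D = ennreal d" "0 \<le> d"
    by (cases D) (auto simp: top_unique)
  have step1: "D \<le> ennreal ((1 - t)\<^sup>2) * ?N F + ennreal (t\<^sup>2 * b)"
    if F: "F \<in> C" "?N F < \<infinity>" and t: "0 \<le> t" "t \<le> 1" for F t
  proof -
    note [measurable] = meas[OF F(1)] meas[OF gC]
    have "(\<lambda>n. ennreal ((1 - t)\<^sup>2) * ?N F + 2 * (\<integral>\<^sup>+x. ennreal \<bar>F x * g n x\<bar> \<partial>M) + ennreal (t\<^sup>2 * b))
        \<longlonglongrightarrow> ennreal ((1 - t)\<^sup>2) * ?N F + 2 * 0 + ennreal (t\<^sup>2 * b)"
      using l2_pairing_tendsto_0[OF _ _ F(2) g b lim]
      by (intro tendsto_add tendsto_const ennreal_tendsto_cmult) auto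
    moreover have "D \<le> ennreal ((1 - t)\<^sup>2) * ?N F + 2 * (\<integral>\<^sup>+x. ennreal \<bar>F x * g n x\<bar> \<partial>M) + ennreal (t\<^sup>2 * b)" for n
    proof -
      have "D \<le> ?N (\<lambda>x. (1 - t) * F x + t * g n x)"
        using cvx F gC t by (intro D_le) (auto simp: convex_functions_def)
      also have "\<dots> \<le> ennreal ((1 - t)\<^sup>2) * ?N F + 2 * (\<integral>\<^sup>+x. ennreal \<bar>F x * g n x\<bar> \<partial>M) + ennreal (t\<^sup>2) * ?N (g n)"
        using t by (intro l2_norm_convex_comb_le) auto
      also have "\<dots> \<le> ennreal ((1 - t)\<^sup>2) * ?N F + 2 * (\<integral>\<^sup>+x. ennreal \<bar>F x * g n x\<bar> \<partial>M) + ennreal (t\<^sup>2 * b)"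
        using g[of n] b by (intro add_left_mono) (simp add: ennreal_mult mult_left_mono)
      finally show ?thesis .
    qed
    ultimately show ?thesis
      by (simp add: LIMSEQ_le_const)
  qed
  have step2: "d \<le> (1 - t)\<^sup>2 * d + t\<^sup>2 * b" if t: "0 \<le> t" "t \<le> 1" for t
  proof (rule field_le_epsilon)
    fix e :: real assume e: "0 < e"
    have "D < D + ennreal e" using e d by (simp add: ennreal_plus[symmetric] ennreal_less_iff del: ennreal_plus)
    then obtain F where F: "F \<in> C" "?N F < D + ennreal e"
      unfolding D_def by (auto simp: INF_less_iff)
    have fin: "?N F < \<infinity>" using F(2) d by (auto simp: less_top[symmetric])
    have "ennreal d \<le> ennreal ((1 - t)\<^sup>2) * ?N F + ennreal (t\<^sup>2 * b)"
      using step1[OF F(1) fin t] d(1) by simp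
    also have "\<dots> \<le> ennreal ((1 - t)\<^sup>2) * ennreal (d + e) + ennreal (t\<^sup>2 * b)"
      using F(2) d e by (intro add_right_mono mult_left_mono) auto
    also have "\<dots> = ennreal ((1 - t)\<^sup>2 * (d + e) + t\<^sup>2 * b)"
      using d(2) e b by (subst ennreal_mult[symmetric]) (auto intro!: ennreal_plus[symmetric] mult_nonneg_nonneg)
    finally have "d \<le> (1 - t)\<^sup>2 * (d + e) + t\<^sup>2 * b"
      using d(2) e b by (subst (asm) ennreal_le_iff) (auto intro!: add_nonneg_nonneg mult_nonneg_nonneg)
    also have "\<dots> \<le> (1 - t)\<^sup>2 * d + t\<^sup>2 * b + e"
    proof -
      have "(1 - t)\<^sup>2 * e \<le> 1 * e" using t e by (intro mult_right_mono power_le_one) auto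
      then show ?thesis by (simp add: algebra_simps)
    qed
    finally show "d \<le> (1 - t)\<^sup>2 * d + t\<^sup>2 * b + e" .
  qed
  have "d \<le> 0"
  proof (rule ccontr)
    assume "\<not> d \<le> 0"
    then have dpos: "0 < d" by simp
    \<comment> \<open>Small enough that the quadratic cost \<open>t\<^sup>2 (d + b)\<close> stays below the gain \<open>2 t d\<close>.\<close>
    define t where "t = d / (d + b + 1)"
    have t: "0 < t" "t \<le> 1" using dpos b by (auto simp: t_def field_simps)
    have "t * (2 * d) \<le> t * (t * (d + b))"
      using step2[of t] t by (simp add: power2_eq_square algebra_simps)
    then have "2 * d \<le> t * (d + b)" using t by simp
    also have "\<dots> \<le> d" using dpos b by (simp add: t_def field_simps)
    finally show False using dpos by simp
  qed
  then show ?thesis using d D_def by simp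
qed

lemma ennreal_half_plus_half: "(e::ennreal) / 2 + e / 2 = e"
proof (cases e)
  case (real r)
  have "ennreal r / 2 = ennreal (r / 2)"
    using real by (metis divide_ennreal ennreal_numeral zero_less_numeral)
  then show ?thesis using real by (simp flip: ennreal_plus)
qed (simp add: ennreal_top_divide)

lemma square_add_le: "((a::real) + b)\<^sup>2 \<le> 2 * a\<^sup>2 + 2 * b\<^sup>2"
  using zero_le_power2[of "a - b"] by (simp add: power2_sum power2_diff)

lemma l2_norm_add_le:
  fixes f g :: "'a \<Rightarrow> real"
  assumes [measurable]: "f \<in> borel_measurable M" "g \<in> borel_measurable M"
  shows "(\<integral>\<^sup>+x. ennreal ((f x + g x)\<^sup>2) \<partial>M) \<le>
    2 * (\<integral>\<^sup>+x. ennreal ((f x)\<^sup>2) \<partial>M) + 2 * (\<integral>\<^sup>+x. ennreal ((g x)\<^sup>2) \<partial>M)"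
proof -
  have "(\<integral>\<^sup>+x. ennreal ((f x + g x)\<^sup>2) \<partial>M) \<le> (\<integral>\<^sup>+x. 2 * ennreal ((f x)\<^sup>2) + 2 * ennreal ((g x)\<^sup>2) \<partial>M)"
  proof (intro nn_integral_mono)
    fix x
    have "ennreal ((f x + g x)\<^sup>2) \<le> ennreal (2 * (f x)\<^sup>2 + 2 * (g x)\<^sup>2)"
      by (intro ennreal_leI square_add_le)
    also have "\<dots> = 2 * ennreal ((f x)\<^sup>2) + 2 * ennreal ((g x)\<^sup>2)"
      by (simp add: ennreal_mult)
    finally show "ennreal ((f x + g x)\<^sup>2) \<le> \<dots>" .
  qed
  also have "\<dots> = 2 * (\<integral>\<^sup>+x. ennreal ((f x)\<^sup>2) \<partial>M) + 2 * (\<integral>\<^sup>+x. ennreal ((g x)\<^sup>2) \<partial>M)"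
    by (simp add: nn_integral_add nn_integral_cmult)
  finally show ?thesis .
qed

lemma l2_norm_limit_le:
  fixes g :: "nat \<Rightarrow> 'a \<Rightarrow> real"
  assumes [measurable]: "\<And>n. g n \<in> borel_measurable M"
    and g: "\<And>n. (\<integral>\<^sup>+x. ennreal ((g n x)\<^sup>2) \<partial>M) \<le> B"
    and lim: "AE x in M. (\<lambda>n. g n x) \<longlonglongrightarrow> f x"
  shows "(\<integral>\<^sup>+x. ennreal ((f x)\<^sup>2) \<partial>M) \<le> B"
proof -
  have "(\<integral>\<^sup>+x. ennreal ((f x)\<^sup>2) \<partial>M) = (\<integral>\<^sup>+x. liminf (\<lambda>n. ennreal ((g n x)\<^sup>2)) \<partial>M)"
    using lim
  proof (intro nn_integral_cong_AE, eventually_elim)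
    case (elim x)
    have "(\<lambda>n. ennreal ((g n x)\<^sup>2)) \<longlonglongrightarrow> ennreal ((f x)\<^sup>2)"
      by (intro tendsto_ennrealI tendsto_intros elim)
    then show ?case by (simp only: lim_imp_Liminf[OF trivial_limit_sequentially])
  qed
  also have "\<dots> \<le> liminf (\<lambda>n. \<integral>\<^sup>+x. ennreal ((g n x)\<^sup>2) \<partial>M)"
    by (intro nn_integral_liminf) auto
  also have "\<dots> \<le> liminf (\<lambda>n. B)"
    by (intro Liminf_mono always_eventually allI g)
  also have "\<dots> = B" by (simp add: Liminf_const)
  finally show ?thesis .
qed

text \<open>
  Translating \<open>C\<close> by \<open>f\<close> reduces the claim to the limit 0. The norm of \<open>f\<close> is controlled by Fatou's lemma.
\<close>

lemma mazur:
  fixes C :: "('a \<Rightarrow> real) set" and g :: "nat \<Rightarrow> 'a \<Rightarrow> real"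
  assumes cvx: "convex_functions C" and meas: "\<And>h. h \<in> C \<Longrightarrow> h \<in> borel_measurable M"
    and f[measurable]: "f \<in> borel_measurable M"
    and gC: "\<And>n. g n \<in> C"
    and g: "\<And>n. (\<integral>\<^sup>+x. ennreal ((g n x)\<^sup>2) \<partial>M) \<le> ennreal b" and b: "0 \<le> b"
    and lim: "AE x in M. (\<lambda>n. g n x) \<longlonglongrightarrow> f x"
  shows "f \<in> l2_closure M C"
proof -
  note [measurable] = meas[OF gC]
  define C' where "C' = (\<lambda>h x. f x - h x) ` C"
  have cvx': "convex_functions C'"
    unfolding convex_functions_def C'_def
  proof safe
    fix t :: real and h k assume t: "0 \<le> t" "t \<le> 1" and hk: "h \<in> C" "k \<in> C"
    have "(\<lambda>x. (1 - t) * h x + t * k x) \<in> C"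
      using cvx t hk by (auto simp: convex_functions_def)
    moreover have "(\<lambda>x. (1 - t) * (f x - h x) + t * (f x - k x)) = (\<lambda>x. f x - ((1 - t) * h x + t * k x))"
      by (auto simp: algebra_simps)
    ultimately show "(\<lambda>x. (1 - t) * (f x - h x) + t * (f x - k x)) \<in> (\<lambda>h x. f x - h x) ` C"
      by (auto intro: image_eqI[rotated])
  qed
  have N_f: "(\<integral>\<^sup>+x. ennreal ((f x)\<^sup>2) \<partial>M) \<le> ennreal b"
    by (rule l2_norm_limit_le[OF _ g lim]) auto
  have "(INF h\<in>C'. \<integral>\<^sup>+x. ennreal ((h x)\<^sup>2) \<partial>M) = 0"
  proof (rule mazur_at_0[where g = "\<lambda>n x. f x - g n x"])
    show "convex_functions C'" by (rule cvx')
    show "h \<in> borel_measurable M" if "h \<in> C'" for h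
      using that meas by (auto simp: C'_def)
    show "(\<lambda>x. f x - g n x) \<in> C'" for n using gC by (auto simp: C'_def)
    show "(\<integral>\<^sup>+x. ennreal ((f x - g n x)\<^sup>2) \<partial>M) \<le> ennreal (4 * b)" for n
    proof -
      have "(\<integral>\<^sup>+x. ennreal ((f x + - g n x)\<^sup>2) \<partial>M) \<le>
          2 * (\<integral>\<^sup>+x. ennreal ((f x)\<^sup>2) \<partial>M) + 2 * (\<integral>\<^sup>+x. ennreal ((- g n x)\<^sup>2) \<partial>M)"
        by (rule l2_norm_add_le) auto
      also have "\<dots> \<le> 2 * ennreal b + 2 * ennreal b"
        using N_f g[of n] by (intro add_mono mult_left_mono) auto
      also have "\<dots> = ennreal (4 * b)"
        using b by (simp add: ennreal_mult flip: distrib_right)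
      finally show ?thesis by simp
    qed
    show "AE x in M. (\<lambda>n. f x - g n x) \<longlonglongrightarrow> 0"
      using lim by eventually_elim (auto intro!: tendsto_eq_intros)
  qed (use b in auto)
  then have "\<exists>h\<in>C. (\<integral>\<^sup>+x. ennreal ((f x - h x)\<^sup>2) \<partial>M) < e" if "0 < e" for e
  proof -
    have "(INF h\<in>C'. \<integral>\<^sup>+x. ennreal ((h x)\<^sup>2) \<partial>M) < e"
      using that \<open>(INF h\<in>C'. _) = 0\<close> by simp
    then show ?thesis
      unfolding INF_less_iff by (auto simp: C'_def)
  qed
  then show ?thesis using f unfolding l2_closure_def by blast
qed

lemma convex_l2_closure:
  assumes cvx: "convex_functions C" and meas: "\<And>h. h \<in> C \<Longrightarrow> h \<in> borel_measurable M"
  shows "convex_functions (l2_closure M C)"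
  unfolding convex_functions_def
proof safe
  fix t :: real and f g assume t: "0 \<le> t" "t \<le> 1" and fg: "f \<in> l2_closure M C" "g \<in> l2_closure M C"
  have [measurable]: "f \<in> borel_measurable M" "g \<in> borel_measurable M"
    using fg by (auto simp: l2_closure_def)
  have "\<exists>h\<in>C. (\<integral>\<^sup>+x. ennreal (((1 - t) * f x + t * g x - h x)\<^sup>2) \<partial>M) < e" if e: "0 < e" for e
  proof -
    have e4: "0 < e / 2 / 2" using e by (simp add: ennreal_zero_less_divide)
    obtain h where h: "h \<in> C" "(\<integral>\<^sup>+x. ennreal ((f x - h x)\<^sup>2) \<partial>M) < e / 2 / 2"
      using fg(1) e4 by (auto simp: l2_closure_def)
    obtain k where k: "k \<in> C" "(\<integral>\<^sup>+x. ennreal ((g x - k x)\<^sup>2) \<partial>M) < e / 2 / 2"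
      using fg(2) e4 by (auto simp: l2_closure_def)
    note [measurable] = meas[OF h(1)] meas[OF k(1)]
    let ?l = "\<lambda>x. (1 - t) * h x + t * k x"
    have "?l \<in> C" using cvx h k t by (auto simp: convex_functions_def)
    moreover have "(\<integral>\<^sup>+x. ennreal (((1 - t) * f x + t * g x - ?l x)\<^sup>2) \<partial>M) < e"
    proof -
      have sq: "((1 - t) * f x + t * g x - ?l x)\<^sup>2 \<le> 2 * (f x - h x)\<^sup>2 + 2 * (g x - k x)\<^sup>2" for x
      proof -
        have "((1 - t) * f x + t * g x - ?l x)\<^sup>2 = ((1 - t) * (f x - h x) + t * (g x - k x))\<^sup>2"
          by (simp add: algebra_simps)
        also have "\<dots> \<le> 2 * ((1 - t)\<^sup>2 * (f x - h x)\<^sup>2) + 2 * (t\<^sup>2 * (g x - k x)\<^sup>2)"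
          using square_add_le[of "(1 - t) * (f x - h x)" "t * (g x - k x)"]
          by (simp add: power_mult_distrib)
        also have "\<dots> \<le> 2 * (1 * (f x - h x)\<^sup>2) + 2 * (1 * (g x - k x)\<^sup>2)"
          using t by (intro add_mono mult_left_mono mult_right_mono power_le_one) auto
        finally show ?thesis by simp
      qed
      have "(\<integral>\<^sup>+x. ennreal (((1 - t) * f x + t * g x - ?l x)\<^sup>2) \<partial>M) \<le>
          (\<integral>\<^sup>+x. 2 * ennreal ((f x - h x)\<^sup>2) + 2 * ennreal ((g x - k x)\<^sup>2) \<partial>M)"
      proof (intro nn_integral_mono)
        fix x show "ennreal (((1 - t) * f x + t * g x - ?l x)\<^sup>2) \<le> 2 * ennreal ((f x - h x)\<^sup>2) + 2 * ennreal ((g x - k x)\<^sup>2)"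
          using ennreal_leI[OF sq[of x]] by (simp add: ennreal_mult)
      qed
      also have "\<dots> = 2 * ((\<integral>\<^sup>+x. ennreal ((f x - h x)\<^sup>2) \<partial>M) + (\<integral>\<^sup>+x. ennreal ((g x - k x)\<^sup>2) \<partial>M))"
        by (simp add: nn_integral_add nn_integral_cmult distrib_left)
      also have "\<dots> < 2 * (e / 2 / 2 + e / 2 / 2)"
        by (intro ennreal_mult_strict_left_mono add_strict_mono h k) auto
      also have "\<dots> = e"
        by (simp only: ennreal_half_plus_half mult_2)
      finally show ?thesis .
    qed
    ultimately show ?thesis by (intro bexI[of _ ?l])
  qed
  then show "(\<lambda>x. (1 - t) * f x + t * g x) \<in> l2_closure M C"
    by (auto simp: l2_closure_def)
qed

lemma l2_closure_idem:
  assumes meas: "\<And>h. h \<in> C \<Longrightarrow> h \<in> borel_measurable M"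
    and f: "f \<in> l2_closure M (l2_closure M C)"
  shows "f \<in> l2_closure M C"
proof -
  have [measurable]: "f \<in> borel_measurable M" using f by (auto simp: l2_closure_def)
  have "\<exists>h\<in>C. (\<integral>\<^sup>+x. ennreal ((f x - h x)\<^sup>2) \<partial>M) < e" if e: "0 < e" for e
  proof -
    have e4: "0 < e / 2 / 2" using e by (simp add: ennreal_zero_less_divide)
    obtain g where g: "g \<in> l2_closure M C" "(\<integral>\<^sup>+x. ennreal ((f x - g x)\<^sup>2) \<partial>M) < e / 2 / 2"
      using f e4 unfolding l2_closure_def[of M "l2_closure M C"] by auto
    obtain h where h: "h \<in> C" "(\<integral>\<^sup>+x. ennreal ((g x - h x)\<^sup>2) \<partial>M) < e / 2 / 2"
      using g(1) e4 by (auto simp: l2_closure_def)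
    have [measurable]: "g \<in> borel_measurable M" using g by (auto simp: l2_closure_def)
    note [measurable] = meas[OF h(1)]
    have "(\<integral>\<^sup>+x. ennreal ((f x - h x)\<^sup>2) \<partial>M) = (\<integral>\<^sup>+x. ennreal (((f x - g x) + (g x - h x))\<^sup>2) \<partial>M)"
      by simp
    also have "\<dots> \<le> 2 * (\<integral>\<^sup>+x. ennreal ((f x - g x)\<^sup>2) \<partial>M) + 2 * (\<integral>\<^sup>+x. ennreal ((g x - h x)\<^sup>2) \<partial>M)"
      by (rule l2_norm_add_le) auto
    also have "\<dots> = 2 * ((\<integral>\<^sup>+x. ennreal ((f x - g x)\<^sup>2) \<partial>M) + (\<integral>\<^sup>+x. ennreal ((g x - h x)\<^sup>2) \<partial>M))"
      by (simp add: distrib_left)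
    also have "\<dots> < 2 * (e / 2 / 2 + e / 2 / 2)"
      by (intro ennreal_mult_strict_left_mono add_strict_mono g h) auto
    also have "\<dots> = e"
      by (simp only: ennreal_half_plus_half mult_2)
    finally show ?thesis using h by blast
  qed
  then show ?thesis by (auto simp: l2_closure_def)
qed

section \<open>Green functions of killed walks\<close>

text \<open>
  The weight of the \<open>k\<close>-step paths from \<open>z\<close> to \<open>y\<close> all of whose vertices after the start lie in \<open>A\<close>. The start is
  exempt, so that \<open>A = - {z}\<close> describes excursions from \<open>z\<close>.
\<close>

fun killed_step :: "('v \<Rightarrow> 'v \<Rightarrow> ennreal) \<Rightarrow> 'v set \<Rightarrow> 'v \<Rightarrow> nat \<Rightarrow> 'v \<Rightarrow> ennreal" where
  "killed_step P A z 0 y = indicator {z} y"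
| "killed_step P A z (Suc k) y =
     indicator A y * (\<integral>\<^sup>+x. killed_step P A z k x * P x y \<partial>count_space UNIV)"

definition green :: "('v \<Rightarrow> 'v \<Rightarrow> ennreal) \<Rightarrow> 'v set \<Rightarrow> 'v \<Rightarrow> 'v \<Rightarrow> ennreal" where
  "green P A z y = (\<Sum>k. killed_step P A z k y)"

lemma sum_killed_step_Suc:
  "(\<Sum>k<Suc m. killed_step P A z k y) =
     indicator {z} y + indicator A y * (\<integral>\<^sup>+x. (\<Sum>k<m. killed_step P A z k x) * P x y \<partial>count_space UNIV)"
  unfolding sum.lessThan_Suc_shift
  by (simp add: sum_distrib_right nn_integral_sum sum_distrib_left)

lemma green_eq:
  "green P A z y =
     indicator {z} y + indicator A y * (\<integral>\<^sup>+x. green P A z x * P x y \<partial>count_space UNIV)"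
proof -
  have "(\<lambda>k. killed_step P A z (Suc k) y) sums (\<Sum>k. killed_step P A z (Suc k) y)"
    by (intro summable_sums summableI)
  then have "(\<lambda>k. killed_step P A z k y) sums ((\<Sum>k. killed_step P A z (Suc k) y) + killed_step P A z 0 y)"
    by (rule sums_Suc)
  then have "green P A z y = (\<Sum>k. killed_step P A z (Suc k) y) + indicator {z} y"
    by (simp add: green_def sums_iff)
  also have "(\<Sum>k. killed_step P A z (Suc k) y) =
      indicator A y * (\<Sum>k. \<integral>\<^sup>+x. killed_step P A z k x * P x y \<partial>count_space UNIV)"
    by simp
  also have "(\<Sum>k. \<integral>\<^sup>+x. killed_step P A z k x * P x y \<partial>count_space UNIV) =
      (\<integral>\<^sup>+x. (\<Sum>k. killed_step P A z k x * P x y) \<partial>count_space UNIV)"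
    by (intro nn_integral_suminf[symmetric]) simp
  also have "\<dots> = (\<integral>\<^sup>+x. green P A z x * P x y \<partial>count_space UNIV)"
    by (simp add: green_def)
  finally show ?thesis by (simp add: add.commute)
qed

text \<open>
  The Green function is the least solution of its defining equation, since the partial sums arise by
  iterating the equation from 0.
\<close>

lemma green_least:
  assumes "\<And>y. indicator {z} y + indicator A y * (\<integral>\<^sup>+x. h x * P x y \<partial>count_space UNIV) \<le> h y"
  shows "green P A z y \<le> h y"
proof -
  have "(\<Sum>k<m. killed_step P A z k y) \<le> h y" for m y
  proof (induction m arbitrary: y)
    case (Suc m)
    have "(\<Sum>k<Suc m. killed_step P A z k y) \<le>
        indicator {z} y + indicator A y * (\<integral>\<^sup>+x. h x * P x y \<partial>count_space UNIV)"
      unfolding sum_killed_step_Suc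
      by (intro add_left_mono mult_left_mono nn_integral_mono mult_right_mono Suc) auto
    then show ?case using assms[of y] by (rule order_trans)
  qed simp
  then show ?thesis
    unfolding green_def by (intro suminf_le_const summableI)
qed

lemma green_mono:
  assumes "A \<subseteq> B"
  shows "green P A z y \<le> green P B z y"
proof (rule green_least)
  fix y
  have "indicator {z} y + indicator A y * (\<integral>\<^sup>+x. green P B z x * P x y \<partial>count_space UNIV) \<le>
    indicator {z} y + indicator B y * (\<integral>\<^sup>+x. green P B z x * P x y \<partial>count_space UNIV)"
    using assms by (intro add_left_mono mult_right_mono) (auto split: split_indicator)
  then show "indicator {z} y + indicator A y * (\<integral>\<^sup>+x. green P B z x * P x y \<partial>count_space UNIV) \<le> green P B z y"
    by (simp only: green_eq[of P B z y, symmetric])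
qed

text \<open>
  By monotone convergence the limit of the killed Green functions solves the equation of the unrestricted one, which is
  the least solution.
\<close>

lemma green_exhaustion:
  assumes inc: "incseq A" and un: "(\<Union>n. A n) = UNIV"
  shows "(\<lambda>n. green P (A n) z y) \<longlonglongrightarrow> green P UNIV z y"
proof -
  let ?h = "\<lambda>y. SUP n. green P (A n) z y"
  have inc_g: "incseq (\<lambda>n. green P (A n) z y)" for y
    using inc by (auto simp: incseq_def intro!: green_mono)
  have "green P UNIV z y \<le> ?h y"
  proof (rule green_least)
    fix y
    obtain m where m: "y \<in> A m" using un by blast
    have "(\<integral>\<^sup>+x. ?h x * P x y \<partial>count_space UNIV) =
        (\<integral>\<^sup>+x. (SUP n. green P (A n) z x * P x y) \<partial>count_space UNIV)"
      by (simp add: SUP_mult_right_ennreal)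
    also have "\<dots> = (SUP n. \<integral>\<^sup>+x. green P (A n) z x * P x y \<partial>count_space UNIV)"
      using inc_g by (intro nn_integral_monotone_convergence_SUP)
        (auto simp: incseq_def le_fun_def intro!: mult_right_mono)
    finally have eq: "(\<integral>\<^sup>+x. ?h x * P x y \<partial>count_space UNIV) =
      (SUP n. \<integral>\<^sup>+x. green P (A n) z x * P x y \<partial>count_space UNIV)" .
    have le: "indicator {z} y + (\<integral>\<^sup>+x. green P (A n) z x * P x y \<partial>count_space UNIV) \<le> ?h y" for n
    proof -
      have "y \<in> A (max n m)" using m incseqD[OF inc, of m "max n m"] by auto
      then have "indicator {z} y + (\<integral>\<^sup>+x. green P (A (max n m)) z x * P x y \<partial>count_space UNIV) =
        green P (A (max n m)) z y"
        by (subst green_eq[of _ _ _ y]) simp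
      moreover have "(\<integral>\<^sup>+x. green P (A n) z x * P x y \<partial>count_space UNIV) \<le>
          (\<integral>\<^sup>+x. green P (A (max n m)) z x * P x y \<partial>count_space UNIV)"
        using inc_g by (intro nn_integral_mono mult_right_mono) (auto simp: incseq_def)
      ultimately have "indicator {z} y + (\<integral>\<^sup>+x. green P (A n) z x * P x y \<partial>count_space UNIV) \<le>
          green P (A (max n m)) z y"
        by (metis add_left_mono)
      also have "\<dots> \<le> ?h y" by (intro SUP_upper) auto
      finally show ?thesis .
    qed
    show "indicator {z} y + indicator UNIV y * (\<integral>\<^sup>+x. ?h x * P x y \<partial>count_space UNIV) \<le> ?h y"
      using le unfolding eq by (simp add: ennreal_SUP_add_right SUP_least)
  qed
  moreover have "?h y \<le> green P UNIV z y"
    by (intro SUP_least green_mono) auto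
  ultimately have "?h y = green P UNIV z y" by (rule antisym[rotated])
  then show ?thesis using LIMSEQ_SUP[OF inc_g[of y]] by simp
qed

text \<open>
  The sum runs over ordered pairs, since weights such as \<open>g(x) P(x,y)\<close> are not symmetric. For symmetric
  weights this is twice the usual energy.
\<close>

definition dirichlet_energy :: "('v \<Rightarrow> 'v \<Rightarrow> ennreal) \<Rightarrow> ('v \<Rightarrow> real) \<Rightarrow> ennreal" where
  "dirichlet_energy w F = (\<integral>\<^sup>+(x, y). w x y * ennreal ((F x - F y)\<^sup>2) \<partial>count_space UNIV)"

lemma nn_integral_pair_count_space:
  "(\<integral>\<^sup>+(x, y). f x y \<partial>count_space UNIV) = (\<integral>\<^sup>+x. \<integral>\<^sup>+y. f x y \<partial>count_space UNIV \<partial>count_space UNIV)"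
  "(\<integral>\<^sup>+(x, y). f x y \<partial>count_space UNIV) = (\<integral>\<^sup>+y. \<integral>\<^sup>+x. f x y \<partial>count_space UNIV \<partial>count_space UNIV)"
  using nn_integral_fst_count_space[of "\<lambda>(x, y). f x y"] nn_integral_snd_count_space[of "\<lambda>(x, y). f x y"]
  by simp_all

text \<open>
  Equality of row sums and column sums is what remains of stationarity: it covers both \<open>\<pi>(x) P(x,y)\<close> for a
  stationary measure \<open>\<pi>\<close> and symmetric conductances. Vertices of weight 0 are admitted, so that networks
  on a subset of the type are included.
\<close>

locale balanced_weights =
  fixes c :: "'v::countable \<Rightarrow> 'v \<Rightarrow> ennreal" and p :: "'v \<Rightarrow> ennreal"
  assumes out_weight: "\<And>x. (\<integral>\<^sup>+y. c x y \<partial>count_space UNIV) = p x"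
    and in_weight: "\<And>y. (\<integral>\<^sup>+x. c x y \<partial>count_space UNIV) = p y"
    and weight_finite: "\<And>x. p x < \<infinity>"
begin

definition walk :: "'v \<Rightarrow> 'v \<Rightarrow> ennreal" where
  "walk x y = c x y / p x"

text \<open>
  Dividing the Green function by the invariant weight turns it into a function that is harmonic, off the pole \<open>z\<close>,
  for the time reversal of the walk.
\<close>

definition potential :: "'v set \<Rightarrow> 'v \<Rightarrow> 'v \<Rightarrow> real" where
  "potential A z x = enn2real (green walk A z x / p x)"

lemma potential_nonneg: "0 \<le> potential A z x"
  by (simp add: potential_def)

lemma c_le_in: "c x y \<le> p y"
  using nn_integral_ge_point[of x UNIV "\<lambda>x. c x y"] by (simp add: in_weight)

text \<open>
  Decomposing a path to \<open>y\<close> at its last visit to \<open>z\<close> bounds the visits to \<open>y\<close> by the visits to \<open>z\<close> times the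
  expected visits to \<open>y\<close> in one excursion from \<open>z\<close>. The latter number is the least solution of an equation
  for which \<open>p y / p z\<close> is a supersolution. Hence finiteness at the pole gives finiteness everywhere, and the
  potential is largest at its pole.
\<close>

lemma green_le_weight_ratio:
  assumes z: "0 < p z"
  shows "green walk A z y \<le> green walk A z z * (p y / p z)"
proof -
  let ?g = "green walk (A - {z}) z"
  have g_le: "?g y \<le> p y / p z" for y
  proof (rule green_least)
    fix y
    have "(\<integral>\<^sup>+x. (p x / p z) * walk x y \<partial>count_space UNIV) \<le> (\<integral>\<^sup>+x. c x y / p z \<partial>count_space UNIV)"
    proof (intro nn_integral_mono)
      fix x
      have "p x * (c x y / p x) \<le> c x y"
        by (cases "p x = 0") (use weight_finite[of x] in \<open>auto simp: ennreal_times_divide mult.commute[of "p x"] mult_divide_eq_ennreal\<close>)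
      then have "(p x * (c x y / p x)) * inverse (p z) \<le> c x y * inverse (p z)"
        by (intro mult_right_mono) auto
      then show "(p x / p z) * walk x y \<le> c x y / p z"
        by (simp add: walk_def divide_ennreal_def mult_ac)
    qed
    also have "\<dots> = p y / p z"
      by (simp add: nn_integral_divide in_weight)
    finally have "(\<integral>\<^sup>+x. (p x / p z) * walk x y \<partial>count_space UNIV) \<le> p y / p z" .
    moreover have "p z / p z = 1"
      using z weight_finite[of z] by (intro ennreal_divide_self) auto
    ultimately show "indicator {z} y + indicator (A - {z}) y * (\<integral>\<^sup>+x. (p x / p z) * walk x y \<partial>count_space UNIV) \<le> p y / p z"
      by (auto split: split_indicator)
  qed
  let ?S = "\<lambda>m y. \<Sum>k<m. killed_step walk A z k y"
  have gz: "?g z = 1" by (subst green_eq) simp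
  \<comment> \<open>The last-exit bound for paths of bounded length, where it follows by induction without a renewal
    equation.\<close>
  have S: "?S m y \<le> ?S m z * ?g y" for m y
  proof (induction m arbitrary: y)
    case (Suc m)
    show ?case
    proof (cases "y = z")
      case True then show ?thesis by (simp add: gz)
    next
      case False
      have "?S (Suc m) y = indicator A y * (\<integral>\<^sup>+x. ?S m x * walk x y \<partial>count_space UNIV)"
        unfolding sum_killed_step_Suc using False by simp
      also have "\<dots> \<le> indicator A y * (\<integral>\<^sup>+x. ?S m z * (?g x * walk x y) \<partial>count_space UNIV)"
        unfolding mult.assoc[symmetric] by (intro mult_left_mono nn_integral_mono mult_right_mono Suc) auto
      also have "\<dots> = ?S m z * (indicator A y * (\<integral>\<^sup>+x. ?g x * walk x y \<partial>count_space UNIV))"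
        by (subst nn_integral_cmult) (simp_all add: mult.left_commute)
      also have "indicator A y * (\<integral>\<^sup>+x. ?g x * walk x y \<partial>count_space UNIV) = ?g y"
        using False by (subst green_eq[of _ _ _ y]) (simp split: split_indicator)
      also have "?S m z * ?g y \<le> ?S (Suc m) z * ?g y"
        by (intro mult_right_mono sum_mono2) auto
      finally show ?thesis .
    qed
  qed simp
  show ?thesis
    unfolding green_def[of walk A z y]
  proof (intro suminf_le_const summableI)
    fix m
    have "?S m y \<le> ?S m z * ?g y" by (rule S)
    also have "\<dots> \<le> green walk A z z * (p y / p z)"
      unfolding green_def[of walk A z z]
      by (intro mult_mono sum_le_suminf g_le) auto
    finally show "?S m y \<le> green walk A z z * (p y / p z)" .
  qed
qed

end

section \<open>Energy of truncated potentials\<close>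

text \<open>
  The primitive of \<open>\<lambda>t. min t a\<close> that vanishes at 0.
\<close>

definition huber :: "real \<Rightarrow> real \<Rightarrow> real" where
  "huber a t = (if t \<le> a then t\<^sup>2 / 2 else a\<^sup>2 / 2 + a * (t - a))"

text \<open>
  The Bregman divergence of \<open>\<Phi>\<close>, where \<open>\<phi>\<close> plays the role of the derivative of \<open>\<Phi>\<close>.
\<close>

definition bregman :: "(real \<Rightarrow> real) \<Rightarrow> (real \<Rightarrow> real) \<Rightarrow> real \<Rightarrow> real \<Rightarrow> real" where
  "bregman \<Phi> \<phi> s t = \<Phi> s - \<Phi> t - \<phi> t * (s - t)"

lemma bregman_huber:
  "bregman (huber a) (\<lambda>t. min t a) s t =
     (if s \<le> a \<or> a < t then (min s a - min t a)\<^sup>2 / 2 else (a - t)\<^sup>2 / 2 + (a - t) * (s - a))"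
  by (auto simp: bregman_def huber_def min_def power2_eq_square field_simps)

lemma truncation_le_bregman_huber:
  "(min s a - min t a)\<^sup>2 \<le> 2 * bregman (huber a) (\<lambda>t. min t a) s t"
  by (auto simp: bregman_huber)

text \<open>
  The factor \<open>s\<close> is harmless even if \<open>s\<close> is far above \<open>a\<close>: for \<open>t \<le> a < s\<close> the divergence contains the linear term
  \<open>(a - t) (s - a)\<close>, which grows with \<open>s\<close>. This is why truncation produces bounded energy for the weights
  \<open>v(x) c(x,y)\<close>.
\<close>

lemma weighted_truncation_le_bregman_huber:
  assumes "0 \<le> s" "0 \<le> t" "0 \<le> a"
  shows "s * (min s a - min t a)\<^sup>2 \<le> 2 * a * bregman (huber a) (\<lambda>t. min t a) s t"
proof (cases "s \<le> a \<or> a < t")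
  case True
  have "s * (min s a - min t a)\<^sup>2 \<le> a * (min s a - min t a)\<^sup>2"
    using True by (cases "s \<le> a") (auto intro: mult_right_mono)
  then show ?thesis using True by (simp add: bregman_huber)
next
  case False
  then have le: "t \<le> a" "a < s" by auto
  have "(s - a) * (a - t)\<^sup>2 \<le> (s - a) * (a - t) * a"
    unfolding power2_eq_square mult.assoc[symmetric]
    using le assms by (intro mult_left_mono) auto
  then have "s * (a - t)\<^sup>2 \<le> a * (a - t)\<^sup>2 + a * ((a - t) * (s - a))"
    by (simp add: algebra_simps)
  also have "\<dots> \<le> a * (a - t)\<^sup>2 + 2 * (a * ((a - t) * (s - a)))"
    using le assms by simp
  finally show ?thesis using le False by (simp add: bregman_huber algebra_simps)
qed

context balanced_weights
begin

text \<open>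
  Multiply the equation of \<open>v\<close> at \<open>y\<close> by \<open>\<phi> (v y)\<close> and sum. The terms with \<open>\<Phi>\<close> cancel because row sums and
  column sums of \<open>c\<close> coincide. To stay within nonnegative sums, the identity is written with all negative
  terms moved to the other side; they are finite because \<open>v\<close> has finite support, so they can be cancelled at the end.
\<close>

lemma bregman_energy:
  assumes A: "finite A" and v0: "\<And>x. 0 \<le> v x" and vA: "\<And>x. x \<notin> A \<Longrightarrow> v x = 0"
    and eq: "\<And>y. y \<in> A \<Longrightarrow> ennreal (v y) * p y = indicator {z} y + (\<integral>\<^sup>+x. ennreal (v x) * c x y \<partial>count_space UNIV)"
    and \<Phi>: "\<Phi> 0 = 0" "\<And>t. 0 \<le> t \<Longrightarrow> 0 \<le> \<Phi> t"
    and \<phi>: "\<phi> 0 = 0" "\<And>t. 0 \<le> t \<Longrightarrow> 0 \<le> \<phi> t"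
    and D: "\<And>s t. 0 \<le> s \<Longrightarrow> 0 \<le> t \<Longrightarrow> 0 \<le> bregman \<Phi> \<phi> s t"
  shows "(\<integral>\<^sup>+(x, y). c x y * ennreal (bregman \<Phi> \<phi> (v x) (v y)) \<partial>count_space UNIV) = ennreal (\<phi> (v z))"
proof -
  let ?C = "count_space UNIV"
  define T where "T = (\<integral>\<^sup>+(x, y). c x y * ennreal (bregman \<Phi> \<phi> (v x) (v y)) \<partial>?C)"
  define S where "S = (\<integral>\<^sup>+x. p x * ennreal (\<Phi> (v x)) \<partial>?C)"
  define L where "L = (\<integral>\<^sup>+(x, y). c x y * ennreal (\<phi> (v y) * v x) \<partial>?C)"
  have fin: "(\<integral>\<^sup>+x. p x * ennreal (h (v x)) \<partial>?C) < \<infinity>" if "h 0 = 0" for h :: "real \<Rightarrow> real"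
  proof -
    have "(\<integral>\<^sup>+x. p x * ennreal (h (v x)) \<partial>?C) = (\<Sum>x\<in>A. p x * ennreal (h (v x)))"
      using A vA that by (intro nn_integral_count_space') auto
    also have "\<dots> < \<infinity>"
      using A weight_finite by (simp add: ennreal_mult_less_top)
    finally show ?thesis .
  qed
  have S1: "(\<integral>\<^sup>+(x, y). c x y * ennreal (\<Phi> (v x)) \<partial>?C) = S"
    by (subst nn_integral_pair_count_space(1)) (simp add: S_def nn_integral_multc out_weight)
  have S2: "(\<integral>\<^sup>+(x, y). c x y * ennreal (\<Phi> (v y)) \<partial>?C) = S"
    by (subst nn_integral_pair_count_space(2)) (simp add: S_def nn_integral_multc in_weight)
  have L1: "(\<integral>\<^sup>+(x, y). c x y * ennreal (\<phi> (v y) * v y) \<partial>?C) = (\<integral>\<^sup>+y. p y * ennreal (\<phi> (v y) * v y) \<partial>?C)"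
    by (subst nn_integral_pair_count_space(2)) (simp add: nn_integral_multc in_weight)
  have L2: "L = (\<integral>\<^sup>+y. ennreal (\<phi> (v y)) * (\<integral>\<^sup>+x. ennreal (v x) * c x y \<partial>?C) \<partial>?C)"
    unfolding L_def
    by (subst nn_integral_pair_count_space(2))
      (simp add: nn_integral_cmult[symmetric] ennreal_mult \<phi> v0 mult_ac)
  have pt: "p y * ennreal (\<phi> (v y) * v y) =
      ennreal (\<phi> (v z)) * indicator {z} y + ennreal (\<phi> (v y)) * (\<integral>\<^sup>+x. ennreal (v x) * c x y \<partial>?C)" for y
  proof (cases "y \<in> A")
    case True
    have "p y * ennreal (\<phi> (v y) * v y) = ennreal (\<phi> (v y)) * (ennreal (v y) * p y)"
      by (simp add: ennreal_mult \<phi> v0 mult_ac)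
    also have "\<dots> = ennreal (\<phi> (v y)) * indicator {z} y + ennreal (\<phi> (v y)) * (\<integral>\<^sup>+x. ennreal (v x) * c x y \<partial>?C)"
      by (simp add: eq[OF True] distrib_left)
    also have "ennreal (\<phi> (v y)) * indicator {z} y = ennreal (\<phi> (v z)) * indicator {z} y"
      by (auto split: split_indicator)
    finally show ?thesis .
  next
    case False
    then show ?thesis by (auto simp: vA \<phi> split: split_indicator)
  qed
  have L3: "(\<integral>\<^sup>+y. p y * ennreal (\<phi> (v y) * v y) \<partial>?C) = ennreal (\<phi> (v z)) + L"
    unfolding pt L2 by (subst nn_integral_add) (auto simp: nn_integral_cmult)
  have "T + (S + L) = (\<integral>\<^sup>+xy. (\<lambda>(x, y). c x y * ennreal (bregman \<Phi> \<phi> (v x) (v y))) xy +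
      ((\<lambda>(x, y). c x y * ennreal (\<Phi> (v y))) xy + (\<lambda>(x, y). c x y * ennreal (\<phi> (v y) * v x)) xy) \<partial>?C)"
    unfolding T_def S2[symmetric] L_def
    by (simp add: nn_integral_add)
  also have "\<dots> = (\<integral>\<^sup>+xy. (\<lambda>(x, y). c x y * ennreal (\<Phi> (v x))) xy +
      (\<lambda>(x, y). c x y * ennreal (\<phi> (v y) * v y)) xy \<partial>?C)"
  proof (intro nn_integral_cong)
    fix xy :: "'v \<times> 'v"
    obtain x y where xy: "xy = (x, y)" by (cases xy)
    have "ennreal (bregman \<Phi> \<phi> (v x) (v y)) + (ennreal (\<Phi> (v y)) + ennreal (\<phi> (v y) * v x)) =
        ennreal (\<Phi> (v x)) + ennreal (\<phi> (v y) * v y)"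
    proof -
      have *: "0 \<le> bregman \<Phi> \<phi> (v x) (v y)" "0 \<le> \<Phi> (v y)" "0 \<le> \<phi> (v y) * v x" "0 \<le> \<Phi> (v x)" "0 \<le> \<phi> (v y) * v y"
        using D \<Phi>(2) \<phi>(2) v0 by simp_all
      have "bregman \<Phi> \<phi> (v x) (v y) + (\<Phi> (v y) + \<phi> (v y) * v x) = \<Phi> (v x) + \<phi> (v y) * v y"
        by (simp add: bregman_def algebra_simps)
      then show ?thesis
        using * by (metis add_nonneg_nonneg ennreal_plus)
    qed
    then show "(\<lambda>(x, y). c x y * ennreal (bregman \<Phi> \<phi> (v x) (v y))) xy +
      ((\<lambda>(x, y). c x y * ennreal (\<Phi> (v y))) xy + (\<lambda>(x, y). c x y * ennreal (\<phi> (v y) * v x)) xy) =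
      (\<lambda>(x, y). c x y * ennreal (\<Phi> (v x))) xy + (\<lambda>(x, y). c x y * ennreal (\<phi> (v y) * v y)) xy"
      unfolding xy by (simp add: distrib_left[symmetric])
  qed
  also have "\<dots> = S + (ennreal (\<phi> (v z)) + L)"
    unfolding S1[symmetric] L3[symmetric] L1[symmetric] by (subst nn_integral_add) auto
  also have "\<dots> = ennreal (\<phi> (v z)) + (S + L)"
    by (simp add: ac_simps)
  finally have "T + (S + L) = ennreal (\<phi> (v z)) + (S + L)" .
  moreover have "S + L < \<infinity>"
  proof -
    have "L \<le> (\<integral>\<^sup>+y. p y * ennreal (\<phi> (v y) * v y) \<partial>?C)" by (simp add: L3)
    also have "\<dots> < \<infinity>" using fin[of "\<lambda>t. \<phi> t * t"] by simp
    finally show ?thesis using fin[of \<Phi>] \<Phi> by (simp add: S_def)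
  qed
  ultimately show ?thesis
    by (auto simp: T_def[symmetric])
qed

context
  fixes z
  assumes pole: "0 < p z" and green_pole: "green walk UNIV z z < \<infinity>"
begin

lemma green_pole_finite: "green walk A z z < \<infinity>"
  using green_mono[of A UNIV walk z z] green_pole by (auto intro: le_less_trans)

lemma green_finite: "green walk A z y < \<infinity>"
proof -
  have "p y / p z < \<infinity>"
    using pole weight_finite[of y] by (auto simp: ennreal_divide_eq_top_iff less_top[symmetric])
  then have "green walk A z z * (p y / p z) < \<infinity>"
    using green_pole_finite by (simp add: ennreal_mult_less_top)
  then show ?thesis using green_le_weight_ratio[OF pole] by (rule le_less_trans[rotated])
qed

lemma green_null: "p y = 0 \<Longrightarrow> green walk A z y = 0"
  using green_le_weight_ratio[OF pole, of A y] by simp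

lemma ennreal_potential: "ennreal (potential A z x) = green walk A z x / p x"
proof -
  have "green walk A z x / p x < \<infinity>"
    using green_finite[of A x] green_null[of x A]
    by (cases "p x = 0") (auto simp: ennreal_divide_eq_top_iff less_top[symmetric])
  then show ?thesis by (simp add: potential_def)
qed

lemma potential_mult_c: "ennreal (potential A z x) * c x y = green walk A z x * walk x y"
  by (simp add: ennreal_potential walk_def divide_ennreal_def mult_ac)

lemma potential_mult_weight: "ennreal (potential A z x) * p x = green walk A z x"
  using green_null[of x A] weight_finite[of x]
  by (cases "p x = 0") (auto simp: ennreal_potential ennreal_divide_times mult_divide_eq_ennreal)

lemma potential_eq:
  assumes "y \<in> A"
  shows "ennreal (potential A z y) * p y =
    indicator {z} y + (\<integral>\<^sup>+x. ennreal (potential A z x) * c x y \<partial>count_space UNIV)"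
  unfolding potential_mult_c potential_mult_weight using assms by (subst green_eq) simp

lemma potential_outside: "x \<notin> A \<Longrightarrow> x \<noteq> z \<Longrightarrow> potential A z x = 0"
  unfolding potential_def by (subst green_eq) simp

lemma potential_le_pole: "potential A z x \<le> potential A z z"
proof -
  have "green walk A z x / p x \<le> green walk A z z / p z"
  proof (cases "p x = 0")
    case True
    then show ?thesis by (simp add: green_null)
  next
    case False
    have "green walk A z x / p x \<le> green walk A z z * (p x / p z) / p x"
      by (intro divide_right_mono_ennreal green_le_weight_ratio pole)
    also have "\<dots> = green walk A z z / p z * (p x / p x)"
      by (simp add: divide_ennreal_def mult_ac)
    also have "p x / p x = 1"
      using False weight_finite[of x] by (intro ennreal_divide_self) auto
    finally show ?thesis by simp
  qed
  then have "ennreal (potential A z x) \<le> ennreal (potential A z z)"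
    by (simp add: ennreal_potential)
  then show ?thesis by (simp add: ennreal_le_iff potential_nonneg)
qed

lemma potential_mono: "A \<subseteq> B \<Longrightarrow> potential A z x \<le> potential B z x"
proof -
  assume "A \<subseteq> B"
  then have "ennreal (potential A z x) \<le> ennreal (potential B z x)"
    unfolding ennreal_potential by (intro divide_right_mono_ennreal green_mono)
  then show ?thesis by (simp add: ennreal_le_iff potential_nonneg)
qed

lemma potential_exhaustion:
  assumes "incseq A" "(\<Union>n. A n) = UNIV"
  shows "(\<lambda>n. potential (A n) z x) \<longlonglongrightarrow> potential UNIV z x"
proof (cases "p x = 0")
  case True
  then show ?thesis by (simp add: potential_def green_null)
next
  case False
  have "(\<lambda>n. inverse (p x) * green walk (A n) z x) \<longlonglongrightarrow> inverse (p x) * green walk UNIV z x"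
    using False by (intro ennreal_tendsto_cmult green_exhaustion assms) (auto simp: less_top[symmetric])
  then have "(\<lambda>n. ennreal (potential (A n) z x)) \<longlonglongrightarrow> ennreal (potential UNIV z x)"
    by (simp add: ennreal_potential divide_ennreal_def mult.commute)
  then show ?thesis by (simp add: tendsto_ennreal_iff potential_nonneg)
qed

lemma truncated_bregman_energy:
  assumes "finite A" "z \<in> A" "0 < a"
  shows "(\<integral>\<^sup>+(x, y). c x y * ennreal (bregman (huber a) (\<lambda>t. min t a) (potential A z x) (potential A z y))
    \<partial>count_space UNIV) \<le> ennreal a"
proof -
  have "(\<integral>\<^sup>+(x, y). c x y * ennreal (bregman (huber a) (\<lambda>t. min t a) (potential A z x) (potential A z y))
      \<partial>count_space UNIV) = ennreal (min (potential A z z) a)"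
  proof (rule bregman_energy[OF assms(1)])
    show "potential A z x = 0" if "x \<notin> A" for x
      using that assms(2) by (intro potential_outside) auto
    show "0 \<le> bregman (huber a) (\<lambda>t. min t a) s t" for s t
      using truncation_le_bregman_huber[of s a t] zero_le_power2[of "min s a - min t a"] by linarith
    show "0 \<le> huber a t" if "0 \<le> t" for t
      using that assms by (auto simp: huber_def)
  qed (use assms in \<open>auto simp: potential_nonneg potential_eq huber_def\<close>)
  also have "\<dots> \<le> ennreal a" by (intro ennreal_leI) simp
  finally show ?thesis .
qed

text \<open>
  The second bound is the decisive one: after division by \<open>a\<^sup>2\<close> it no longer depends on \<open>a\<close>. The first one serves
  to bound the energy for the weights \<open>v(x) c(x,y)\<close> of the unrestricted potential \<open>v\<close>, uniformly in \<open>A\<close>.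
\<close>

lemma truncated_potential_energy:
  assumes A: "finite A" "z \<in> A" and a: "0 < a"
  shows "dirichlet_energy c (\<lambda>x. min (potential A z x) a) \<le> ennreal (2 * a)"
    and "dirichlet_energy (\<lambda>x y. ennreal (potential A z x) * c x y) (\<lambda>x. min (potential A z x) a) \<le> ennreal (2 * a\<^sup>2)"
proof -
  let ?v = "potential A z"
  let ?D = "\<lambda>x y. bregman (huber a) (\<lambda>t. min t a) (?v x) (?v y)"
  have "dirichlet_energy c (\<lambda>x. min (?v x) a) \<le> (\<integral>\<^sup>+xy. ennreal 2 * (\<lambda>(x, y). c x y * ennreal (?D x y)) xy \<partial>count_space UNIV)"
    unfolding dirichlet_energy_def
  proof (intro nn_integral_mono, clarify)
    fix x y
    have "ennreal ((min (?v x) a - min (?v y) a)\<^sup>2) \<le> ennreal 2 * ennreal (?D x y)"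
      by (subst ennreal_mult'[symmetric]) (auto intro!: ennreal_leI truncation_le_bregman_huber)
    then show "c x y * ennreal ((min (?v x) a - min (?v y) a)\<^sup>2) \<le> ennreal 2 * (c x y * ennreal (?D x y))"
      by (subst mult.left_commute) (intro mult_left_mono, auto)
  qed
  also have "\<dots> = ennreal 2 * (\<integral>\<^sup>+(x, y). c x y * ennreal (?D x y) \<partial>count_space UNIV)"
    by (rule nn_integral_cmult) simp
  also have "\<dots> \<le> ennreal 2 * ennreal a"
    by (intro mult_left_mono truncated_bregman_energy A a) auto
  finally show "dirichlet_energy c (\<lambda>x. min (?v x) a) \<le> ennreal (2 * a)"
    by (subst ennreal_mult') auto
  have "dirichlet_energy (\<lambda>x y. ennreal (?v x) * c x y) (\<lambda>x. min (?v x) a) \<le>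
      (\<integral>\<^sup>+xy. ennreal (2 * a) * (\<lambda>(x, y). c x y * ennreal (?D x y)) xy \<partial>count_space UNIV)"
    unfolding dirichlet_energy_def
  proof (intro nn_integral_mono, clarify)
    fix x y
    have "ennreal (?v x) * ennreal ((min (?v x) a - min (?v y) a)\<^sup>2) \<le> ennreal (2 * a) * ennreal (?D x y)"
      using a by (subst (1 2) ennreal_mult'[symmetric])
        (auto intro!: ennreal_leI weighted_truncation_le_bregman_huber potential_nonneg)
    then have "c x y * (ennreal (?v x) * ennreal ((min (?v x) a - min (?v y) a)\<^sup>2)) \<le> c x y * (ennreal (2 * a) * ennreal (?D x y))"
      by (intro mult_left_mono) auto
    then show "ennreal (?v x) * c x y * ennreal ((min (?v x) a - min (?v y) a)\<^sup>2) \<le> ennreal (2 * a) * (c x y * ennreal (?D x y))"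
      by (simp add: mult_ac)
  qed
  also have "\<dots> = ennreal (2 * a) * (\<integral>\<^sup>+(x, y). c x y * ennreal (?D x y) \<partial>count_space UNIV)"
    by (rule nn_integral_cmult) simp
  also have "\<dots> \<le> ennreal (2 * a) * ennreal a"
    by (intro mult_left_mono truncated_bregman_energy A a) auto
  also have "\<dots> = ennreal (2 * a\<^sup>2)"
    using a by (subst ennreal_mult[symmetric]) (auto simp: power2_eq_square)
  finally show "dirichlet_energy (\<lambda>x y. ennreal (?v x) * c x y) (\<lambda>x. min (?v x) a) \<le> ennreal (2 * a\<^sup>2)" .
qed

end

end

section \<open>Capacity and the Green function\<close>

text \<open>
  Nonnegativity allows the energy product with a Green function to be computed from nonnegative sums.
\<close>

definition test_function :: "'v \<Rightarrow> ('v \<Rightarrow> real) \<Rightarrow> bool" where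
  "test_function t F \<longleftrightarrow> finite {x. F x \<noteq> 0} \<and> (\<forall>x. 0 \<le> F x) \<and> F t = 1"

definition vanishing_capacity :: "('v \<Rightarrow> 'v \<Rightarrow> ennreal) \<Rightarrow> 'v \<Rightarrow> bool" where
  "vanishing_capacity w t \<longleftrightarrow> (\<forall>e>0. \<exists>F. test_function t F \<and> dirichlet_energy w F < e)"

lemma dirichlet_energy_mono:
  "(\<And>x y. w x y \<le> w' x y) \<Longrightarrow> dirichlet_energy w F \<le> dirichlet_energy w' F"
  unfolding dirichlet_energy_def by (intro nn_integral_mono) (auto intro!: mult_right_mono)

lemma dirichlet_energy_cmult:
  "dirichlet_energy (\<lambda>x y. a * w x y) F = a * dirichlet_energy w F"
proof -
  have "dirichlet_energy (\<lambda>x y. a * w x y) F =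
      (\<integral>\<^sup>+xy. a * (\<lambda>(x, y). w x y * ennreal ((F x - F y)\<^sup>2)) xy \<partial>count_space UNIV)"
    unfolding dirichlet_energy_def by (intro nn_integral_cong) (auto simp: mult.assoc)
  then show ?thesis by (simp add: nn_integral_cmult dirichlet_energy_def)
qed

lemma dirichlet_energy_divide:
  "dirichlet_energy w (\<lambda>x. F x / a) = ennreal (1 / a\<^sup>2) * dirichlet_energy w F"
proof -
  have "dirichlet_energy w (\<lambda>x. F x / a) =
      (\<integral>\<^sup>+xy. ennreal (1 / a\<^sup>2) * (\<lambda>(x, y). w x y * ennreal ((F x - F y)\<^sup>2)) xy \<partial>count_space UNIV)"
    unfolding dirichlet_energy_def
  proof (intro nn_integral_cong, clarify)
    fix x y
    have "(F x / a - F y / a)\<^sup>2 = 1 / a\<^sup>2 * (F x - F y)\<^sup>2"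
      by (simp add: diff_divide_distrib[symmetric] power_divide)
    then show "w x y * ennreal ((F x / a - F y / a)\<^sup>2) = ennreal (1 / a\<^sup>2) * (w x y * ennreal ((F x - F y)\<^sup>2))"
      by (simp only: ennreal_mult'[of "(F x - F y)\<^sup>2" "1 / a\<^sup>2"] zero_le_power2 mult.left_commute ennreal_mult'')
  qed
  then show ?thesis by (simp add: nn_integral_cmult dirichlet_energy_def)
qed

lemma convex_gradients_of_test_functions:
  "convex_functions ((\<lambda>F (x, y). F x - F y) ` Collect (test_function t))"
  unfolding convex_functions_def
proof safe
  fix s :: real and F G :: "'a \<Rightarrow> real"
  assume s: "0 \<le> s" "s \<le> 1" and FG: "test_function t F" "test_function t G"
  let ?H = "\<lambda>x. (1 - s) * F x + s * G x"
  have "{x. ?H x \<noteq> 0} \<subseteq> {x. F x \<noteq> 0} \<union> {x. G x \<noteq> 0}" by auto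
  then have "test_function t ?H"
    using FG s by (auto simp: test_function_def intro: finite_subset)
  moreover have "(\<lambda>xy. (1 - s) * (case xy of (x, y) \<Rightarrow> F x - F y) + s * (case xy of (x, y) \<Rightarrow> G x - G y)) =
      (\<lambda>(x, y). ?H x - ?H y)"
    by (auto simp: fun_eq_iff algebra_simps)
  ultimately show "(\<lambda>xy. (1 - s) * (case xy of (x, y) \<Rightarrow> F x - F y) + s * (case xy of (x, y) \<Rightarrow> G x - G y))
      \<in> (\<lambda>F (x, y). F x - F y) ` Collect (test_function t)"
    by (auto intro: image_eqI[where x = ?H])
qed

context balanced_weights
begin

context
  fixes z
  assumes pole: "0 < p z" and green_pole: "green walk UNIV z z < \<infinity>"
begin

text \<open>
  Fatou's lemma, applied with the weights and the functions both depending on \<open>n\<close>: the bound for \<open>A n\<close> is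
  available only with the potential of \<open>A n\<close> in the weights.
\<close>

lemma truncated_potential_limit_energy:
  assumes a: "0 < a" and A: "\<And>n. finite (A n)" "\<And>n. z \<in> A n" "incseq A" "(\<Union>n. A n) = UNIV"
  shows "dirichlet_energy (\<lambda>x y. ennreal (potential UNIV z x) * c x y) (\<lambda>x. min (potential UNIV z x) a) \<le> ennreal (2 * a\<^sup>2)"
proof -
  let ?e = "\<lambda>B. \<lambda>(x, y). ennreal (potential B z x) * c x y *
    ennreal ((min (potential B z x) a - min (potential B z y) a)\<^sup>2)"
  note lim = potential_exhaustion[OF pole green_pole A(3,4)]
  have "(\<lambda>n. ?e (A n) xy) \<longlonglongrightarrow> ?e UNIV xy" for xy
  proof -
    obtain x y where xy: "xy = (x, y)" by (cases xy)
    have "c x y < \<infinity>" using c_le_in[of x y] weight_finite[of y] by (rule le_less_trans)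
    then have "(\<lambda>n. c x y * ennreal (potential (A n) z x * (min (potential (A n) z x) a - min (potential (A n) z y) a)\<^sup>2))
      \<longlonglongrightarrow> c x y * ennreal (potential UNIV z x * (min (potential UNIV z x) a - min (potential UNIV z y) a)\<^sup>2)"
      by (intro ennreal_tendsto_cmult tendsto_ennrealI tendsto_intros lim) auto
    then show ?thesis
      by (simp add: xy ennreal_mult potential_nonneg mult_ac)
  qed
  then have "dirichlet_energy (\<lambda>x y. ennreal (potential UNIV z x) * c x y) (\<lambda>x. min (potential UNIV z x) a) =
      (\<integral>\<^sup>+xy. liminf (\<lambda>n. ?e (A n) xy) \<partial>count_space UNIV)"
    unfolding dirichlet_energy_def
    by (intro nn_integral_cong) (metis (mono_tags, lifting) lim_imp_Liminf trivial_limit_sequentially)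
  also have "\<dots> \<le> liminf (\<lambda>n. \<integral>\<^sup>+xy. ?e (A n) xy \<partial>count_space UNIV)"
    by (intro nn_integral_liminf) auto
  also have "\<dots> \<le> liminf (\<lambda>n. ennreal (2 * a\<^sup>2))"
    using truncated_potential_energy(2)[OF pole green_pole A(1,2) a]
    unfolding dirichlet_energy_def by (intro Liminf_mono always_eventually allI)
  also have "\<dots> = ennreal (2 * a\<^sup>2)" by (simp add: Liminf_const)
  finally show ?thesis .
qed

text \<open>
  Two passages to the limit, each through Mazur's lemma. First the truncated potentials killed outside the finite sets
  \<open>A n\<close> approximate \<open>min(v, a) / a\<close> for fixed \<open>a\<close>, with an energy bound that deteriorates as \<open>a\<close> decreases. Then
  \<open>a\<close> tends to 0, where Fatou's lemma provides the uniform energy bound 2 and the gradients tend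
  to 0 pointwise.
\<close>

theorem vanishing_capacity_of_crossing_weights:
  assumes green_pos: "\<And>y. 0 < green walk UNIV z y"
  shows "vanishing_capacity (\<lambda>x y. green walk UNIV z x * walk x y) t"
proof -
  let ?v = "potential UNIV z"
  let ?w = "\<lambda>x y. ennreal (?v x) * c x y"
  let ?M = "density (count_space UNIV) (\<lambda>(x, y). ?w x y)"
  let ?grad = "\<lambda>F :: 'v \<Rightarrow> real. \<lambda>(x, y). F x - F y"
  define C where "C = ?grad ` Collect (test_function t)"
  define A where "A n = insert z (from_nat ` {..n})" for n :: nat
  have A: "finite (A n)" "z \<in> A n" "incseq A" "(\<Union>n. A n) = UNIV" for n
  proof -
    have "x \<in> (\<Union>n. A n)" for x :: 'v
      by (rule UN_I[of "to_nat x"]) (auto simp: A_def intro: image_eqI[of _ _ "to_nat x"])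
    then show "(\<Union>n. A n) = UNIV" by auto
  qed (auto simp: A_def incseq_def)
  note lim = potential_exhaustion[OF pole green_pole A(3,4)]
  have v_pos: "0 < ?v x" for x
  proof -
    have "0 < ennreal (?v x)"
      unfolding ennreal_potential[OF pole green_pole]
      using green_pos[of x] weight_finite[of x] by (auto simp: ennreal_zero_less_divide)
    then show ?thesis by simp
  qed
  have norm: "(\<integral>\<^sup>+xy. ennreal ((?grad F xy)\<^sup>2) \<partial>?M) = dirichlet_energy ?w F" for F
    unfolding dirichlet_energy_def by (subst nn_integral_density) (auto intro!: nn_integral_cong)
  have cvx: "convex_functions C"
    unfolding C_def by (rule convex_gradients_of_test_functions)
  have meas: "h \<in> borel_measurable ?M" for h by simp
  have f_closure: "?grad (\<lambda>x. min (?v x) a / a) \<in> l2_closure ?M C" if a: "0 < a" "a < ?v t" for a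
  proof -
    have "eventually (\<lambda>n. a < potential (A n) z t) sequentially"
      using lim[of t] a(2) by (rule order_tendstoD(1))
    \<comment> \<open>Only from here on does the killed potential exceed \<open>a\<close> at \<open>t\<close>, so that its truncation takes the value 1.\<close>
    then obtain n0 where n0: "\<And>n. n0 \<le> n \<Longrightarrow> a < potential (A n) z t"
      by (auto simp: eventually_sequentially)
    let ?f = "\<lambda>n x. min (potential (A (n + n0)) z x) a / a"
    show ?thesis
    proof (rule mazur[OF cvx meas meas, where g = "\<lambda>n. ?grad (?f n)" and b = "2 * ?v z / a"])
      fix n
      have "{x. ?f n x \<noteq> 0} \<subseteq> A (n + n0)"
      proof (rule subsetI, rule ccontr)
        fix x assume x: "x \<in> {x. ?f n x \<noteq> 0}" "x \<notin> A (n + n0)"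
        then have "potential (A (n + n0)) z x = 0"
          using A(2)[of "n + n0"] by (intro potential_outside pole green_pole) auto
        then show False using x a by simp
      qed
      then have "finite {x. ?f n x \<noteq> 0}"
        using A(1) by (rule finite_subset)
      moreover have "\<forall>x. 0 \<le> ?f n x"
        using a by (simp add: potential_nonneg)
      moreover have "?f n t = 1"
        using n0[of "n + n0"] a by simp
      ultimately have "test_function t (?f n)"
        unfolding test_function_def by blast
      then show "?grad (?f n) \<in> C" by (auto simp: C_def)
      have "dirichlet_energy ?w (?f n) \<le> dirichlet_energy (\<lambda>x y. ennreal (?v z) * c x y) (?f n)"
        by (intro dirichlet_energy_mono mult_right_mono ennreal_leI potential_le_pole pole green_pole) auto
      also have "\<dots> = ennreal (?v z) * (ennreal (1 / a\<^sup>2) * dirichlet_energy c (\<lambda>x. min (potential (A (n + n0)) z x) a))"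
        by (simp only: dirichlet_energy_cmult dirichlet_energy_divide)
      also have "\<dots> \<le> ennreal (?v z) * (ennreal (1 / a\<^sup>2) * ennreal (2 * a))"
        by (intro mult_left_mono truncated_potential_energy pole green_pole A a) auto
      also have "\<dots> = ennreal (2 * ?v z / a)"
        using a potential_nonneg[of UNIV z z] by (simp add: ennreal_mult[symmetric] power2_eq_square field_simps)
      finally show "(\<integral>\<^sup>+xy. ennreal ((?grad (?f n) xy)\<^sup>2) \<partial>?M) \<le> ennreal (2 * ?v z / a)"
        by (simp only: norm)
    next
      show "0 \<le> 2 * ?v z / a" using a potential_nonneg[of UNIV z z] by simp
      have "(\<lambda>n. ?grad (?f n) xy) \<longlonglongrightarrow> ?grad (\<lambda>x. min (?v x) a / a) xy" for xy
      proof -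
        obtain x y where xy: "xy = (x, y)" by (cases xy)
        have "(\<lambda>n. ?f n x) \<longlonglongrightarrow> min (?v x) a / a" for x
          using a by (intro tendsto_intros LIMSEQ_ignore_initial_segment lim) auto
        then show ?thesis unfolding xy by (auto intro: tendsto_diff)
      qed
      then show "AE xy in ?M. (\<lambda>n. ?grad (?f n) xy) \<longlonglongrightarrow> ?grad (\<lambda>x. min (?v x) a / a) xy"
        by simp
    qed
  qed
  define a where "a k = ?v t * inverse (real (Suc (Suc k)))" for k :: nat
  have a: "0 < a k" "a k < ?v t" for k
    using v_pos[of t] by (auto simp: a_def field_simps intro!: add_pos_nonneg)
  have a_lim: "a \<longlonglongrightarrow> 0"
    unfolding a_def by (intro tendsto_mult_right_zero LIMSEQ_Suc[OF LIMSEQ_inverse_real_of_nat])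
  let ?f = "\<lambda>k x. min (?v x) (a k) / a k"
  have "(\<lambda>_. 0) \<in> l2_closure ?M (l2_closure ?M C)"
  proof (rule mazur[OF convex_l2_closure[OF cvx meas] meas meas, where g = "\<lambda>k. ?grad (?f k)" and b = 2])
    show "?grad (?f k) \<in> l2_closure ?M C" for k by (rule f_closure[OF a])
    show "(\<integral>\<^sup>+xy. ennreal ((?grad (?f k) xy)\<^sup>2) \<partial>?M) \<le> ennreal 2" for k
    proof -
      have "dirichlet_energy ?w (?f k) \<le> ennreal (1 / (a k)\<^sup>2) * ennreal (2 * (a k)\<^sup>2)"
        unfolding dirichlet_energy_divide by (intro mult_left_mono truncated_potential_limit_energy[OF a(1) A]) auto
      also have "\<dots> = ennreal 2"
        using a(1)[of k] by (simp add: ennreal_mult[symmetric] del: ennreal_numeral)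
      finally show ?thesis by (simp only: norm)
    qed
    have "(\<lambda>k. ?grad (?f k) xy) \<longlonglongrightarrow> 0" for xy
    proof -
      obtain x y where xy: "xy = (x, y)" by (cases xy)
      have "eventually (\<lambda>k. a k < ?v x) sequentially" "eventually (\<lambda>k. a k < ?v y) sequentially"
        using a_lim v_pos by (auto intro: order_tendstoD)
      then have "eventually (\<lambda>k. ?grad (?f k) xy = 0) sequentially"
        by eventually_elim (simp add: xy min_def)
      then show ?thesis by (rule tendsto_eventually)
    qed
    then show "AE xy in ?M. (\<lambda>k. ?grad (?f k) xy) \<longlonglongrightarrow> 0" by simp
  qed simp
  then have zero: "(\<lambda>_. 0) \<in> l2_closure ?M C"
    by (rule l2_closure_idem[OF meas])
  have "\<exists>F. test_function t F \<and> dirichlet_energy ?w F < e" if e: "0 < e" for e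
  proof -
    obtain F where "test_function t F" "(\<integral>\<^sup>+xy. ennreal ((0 - ?grad F xy)\<^sup>2) \<partial>?M) < e"
      using zero e by (auto simp: l2_closure_def C_def)
    then show ?thesis using norm[of F] by auto
  qed
  then show ?thesis
    by (simp add: vanishing_capacity_def potential_mult_c[OF pole green_pole])
qed

text \<open>
  Let \<open>h\<close> be the potential killed outside the support of \<open>F\<close>. Pairing \<open>F\<close> with the equation of \<open>h\<close> gives \<open>F z = 1\<close> for
  the energy product of \<open>F\<close> and \<open>h\<close> (each edge counted once), and \<open>h\<close> has energy \<open>h z\<close>; the Cauchy-Schwarz
  inequality does the rest. It is used in the form of a pointwise inequality between nonnegative terms, which
  avoids signed sums.
\<close>

lemma test_function_energy_ge:
  assumes sym: "\<And>x y. c x y = c y x" and F: "test_function z F"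
  shows "2 \<le> ennreal (potential UNIV z z) * dirichlet_energy c F"
proof -
  let ?C = "count_space UNIV"
  define A where "A = insert z {x. F x \<noteq> 0}"
  have A: "finite A" "z \<in> A" using F by (auto simp: A_def test_function_def)
  have F0: "0 \<le> F x" for x using F by (auto simp: test_function_def)
  have Fz: "F z = 1" using F by (auto simp: test_function_def)
  define h where "h = potential A z"
  have h0: "0 \<le> h x" for x by (simp add: h_def potential_nonneg)
  have h_out: "h x = 0" if "x \<notin> A" for x
    using that A(2) unfolding h_def by (intro potential_outside pole green_pole) auto
  have h_eq: "ennreal (h y) * p y = indicator {z} y + (\<integral>\<^sup>+x. ennreal (h x) * c x y \<partial>?C)" if "y \<in> A" for y
    unfolding h_def by (rule potential_eq[OF pole green_pole that])
  have hz: "0 < h z"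
    using h_eq[OF A(2)] h0[of z] by (cases "h z = 0") auto
  have E_h: "dirichlet_energy c h = ennreal (2 * h z)"
  proof -
    have breg: "bregman (\<lambda>t. t\<^sup>2 / 2) (\<lambda>t. t) r s = (r - s)\<^sup>2 / 2" for r s
      by (simp add: bregman_def power2_eq_square field_simps)
    have "(\<integral>\<^sup>+(x, y). c x y * ennreal (bregman (\<lambda>t. t\<^sup>2 / 2) (\<lambda>t. t) (h x) (h y)) \<partial>?C) = ennreal (h z)"
      by (rule bregman_energy[OF A(1) h0 h_out h_eq])
        (auto simp: breg)
    then have *: "(\<integral>\<^sup>+(x, y). c x y * ennreal ((h x - h y)\<^sup>2 / 2) \<partial>?C) = ennreal (h z)"
      by (simp add: breg)
    have "dirichlet_energy c h = (\<integral>\<^sup>+xy. 2 * (\<lambda>(x, y). c x y * ennreal ((h x - h y)\<^sup>2 / 2)) xy \<partial>?C)"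
      unfolding dirichlet_energy_def
    proof (intro nn_integral_cong, clarify)
      fix x y
      have "ennreal ((h x - h y)\<^sup>2) = ennreal 2 * ennreal ((h x - h y)\<^sup>2 / 2)"
        by (subst ennreal_mult[symmetric]) auto
      then show "c x y * ennreal ((h x - h y)\<^sup>2) = 2 * (c x y * ennreal ((h x - h y)\<^sup>2 / 2))"
        by (simp add: mult.left_commute)
    qed
    also have "\<dots> = 2 * (\<integral>\<^sup>+(x, y). c x y * ennreal ((h x - h y)\<^sup>2 / 2) \<partial>?C)"
      by (rule nn_integral_cmult) simp
    finally show ?thesis using * hz by (simp add: ennreal_mult)
  qed
  define J where "J = (\<integral>\<^sup>+(x, y). c x y * ennreal (h x * F y) \<partial>?C)"
  define S where "S = (\<integral>\<^sup>+x. p x * ennreal (h x * F x) \<partial>?C)"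
  have S1: "(\<integral>\<^sup>+(x, y). c x y * ennreal (h x * F x) \<partial>?C) = S"
    by (subst nn_integral_pair_count_space(1)) (simp add: S_def nn_integral_multc out_weight)
  have S2: "(\<integral>\<^sup>+(x, y). c x y * ennreal (h y * F y) \<partial>?C) = S"
    by (subst nn_integral_pair_count_space(2)) (simp add: S_def nn_integral_multc in_weight)
  have J1: "J = (\<integral>\<^sup>+y. ennreal (F y) * (\<integral>\<^sup>+x. ennreal (h x) * c x y \<partial>?C) \<partial>?C)"
    unfolding J_def
    by (subst nn_integral_pair_count_space(2))
      (simp add: nn_integral_cmult[symmetric] ennreal_mult F0 h0 mult_ac)
  have J2: "(\<integral>\<^sup>+(x, y). c x y * ennreal (h y * F x) \<partial>?C) = J"
  proof -
    have "(\<integral>\<^sup>+(x, y). c x y * ennreal (h y * F x) \<partial>?C) = (\<integral>\<^sup>+x. \<integral>\<^sup>+y. c x y * ennreal (h y * F x) \<partial>?C \<partial>?C)"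
      by (rule nn_integral_pair_count_space(1))
    also have "\<dots> = (\<integral>\<^sup>+y. \<integral>\<^sup>+x. c x y * ennreal (h x * F y) \<partial>?C \<partial>?C)"
      by (subst sym) simp
    also have "\<dots> = J" unfolding J_def by (rule nn_integral_pair_count_space(2)[symmetric])
    finally show ?thesis .
  qed
  have pt: "p y * ennreal (h y * F y) = indicator {z} y + ennreal (F y) * (\<integral>\<^sup>+x. ennreal (h x) * c x y \<partial>?C)" for y
  proof (cases "y \<in> A")
    case True
    have "p y * ennreal (h y * F y) = ennreal (F y) * (ennreal (h y) * p y)"
      by (simp add: ennreal_mult F0 h0 mult_ac)
    also have "\<dots> = ennreal (F y) * indicator {z} y + ennreal (F y) * (\<integral>\<^sup>+x. ennreal (h x) * c x y \<partial>?C)"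
      by (simp add: h_eq[OF True] distrib_left)
    also have "ennreal (F y) * indicator {z} y = indicator {z} y"
      by (auto simp: Fz split: split_indicator)
    finally show ?thesis .
  next
    case False
    then have "F y = 0" "y \<noteq> z" by (auto simp: A_def)
    then show ?thesis by simp
  qed
  have SJ: "S = 1 + J"
    unfolding S_def J1 pt by (subst nn_integral_add) auto
  have "S = (\<Sum>x\<in>A. p x * ennreal (h x * F x))"
    unfolding S_def using A h_out by (intro nn_integral_count_space') auto
  also have "\<dots> < \<infinity>"
    using A weight_finite by (simp add: ennreal_mult_less_top)
  finally have J_fin: "J < \<infinity>" using SJ by simp
  let ?E = "\<lambda>F (x, y). c x y * ennreal ((F x - F y)\<^sup>2)"
  have "S + S = (\<integral>\<^sup>+xy. (\<lambda>(x, y). c x y * ennreal (h x * F x)) xy + (\<lambda>(x, y). c x y * ennreal (h y * F y)) xy \<partial>?C)"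
    by (simp add: nn_integral_add S1 S2)
  also have "\<dots> \<le> (\<integral>\<^sup>+xy. ((\<lambda>(x, y). c x y * ennreal (h x * F y)) xy + (\<lambda>(x, y). c x y * ennreal (h y * F x)) xy)
     + (ennreal (1 / (2 * h z)) * ?E h xy + ennreal (h z / 2) * ?E F xy) \<partial>?C)"
  proof (intro nn_integral_mono, clarify)
    fix x y
    \<comment> \<open>The arithmetic-geometric mean inequality, balanced so that the term in \<open>h\<close> integrates to 1.\<close>
    have "0 \<le> ((h x - h y) - h z * (F x - F y))\<^sup>2 / (2 * h z)"
      using hz by simp
    also have "\<dots> = (1 / (2 * h z)) * (h x - h y)\<^sup>2 + (h z / 2) * (F x - F y)\<^sup>2 - (h x - h y) * (F x - F y)"
      using hz by (simp add: power2_eq_square field_simps)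
    finally have "h x * F x + h y * F y \<le>
        (h x * F y + h y * F x) + ((1 / (2 * h z)) * (h x - h y)\<^sup>2 + (h z / 2) * (F x - F y)\<^sup>2)"
      by (simp add: algebra_simps)
    note le = this
    have "ennreal (h x * F x) + ennreal (h y * F y) = ennreal (h x * F x + h y * F y)"
      by (simp add: h0 F0)
    also have "\<dots> \<le> ennreal ((h x * F y + h y * F x) + ((1 / (2 * h z)) * (h x - h y)\<^sup>2 + (h z / 2) * (F x - F y)\<^sup>2))"
      using le by (rule ennreal_leI)
    also have "\<dots> = (ennreal (h x * F y) + ennreal (h y * F x)) +
        (ennreal (1 / (2 * h z)) * ennreal ((h x - h y)\<^sup>2) + ennreal (h z / 2) * ennreal ((F x - F y)\<^sup>2))"
      using hz by (simp add: ennreal_mult[symmetric] h0 F0 flip: ennreal_plus)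
    finally have "c x y * (ennreal (h x * F x) + ennreal (h y * F y)) \<le> c x y * \<dots>"
      by (rule mult_left_mono) simp
    then show "c x y * ennreal (h x * F x) + c x y * ennreal (h y * F y) \<le>
      c x y * ennreal (h x * F y) + c x y * ennreal (h y * F x) +
        (ennreal (1 / (2 * h z)) * (c x y * ennreal ((h x - h y)\<^sup>2)) + ennreal (h z / 2) * (c x y * ennreal ((F x - F y)\<^sup>2)))"
      by (simp add: distrib_left mult_ac)
  qed
  also have "\<dots> = (J + J) + (ennreal (1 / (2 * h z)) * dirichlet_energy c h + ennreal (h z / 2) * dirichlet_energy c F)"
    by (simp add: nn_integral_add nn_integral_cmult J2 J_def[symmetric] dirichlet_energy_def)
  also have "ennreal (1 / (2 * h z)) * dirichlet_energy c h = 1"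
    using hz unfolding E_h by (subst ennreal_mult[symmetric]) auto
  finally have "(J + J) + (1 + 1) \<le> (J + J) + (1 + ennreal (h z / 2) * dirichlet_energy c F)"
    unfolding SJ by (simp only: ac_simps)
  then have "1 + 1 \<le> 1 + ennreal (h z / 2) * dirichlet_energy c F"
    using J_fin by (subst (asm) ennreal_add_left_cancel_le) auto
  then have "1 \<le> ennreal (h z / 2) * dirichlet_energy c F"
    by (subst (asm) ennreal_add_left_cancel_le) auto
  then have "ennreal 2 * 1 \<le> ennreal 2 * (ennreal (h z / 2) * dirichlet_energy c F)"
    by (intro mult_left_mono) auto
  also have "\<dots> = ennreal (h z) * dirichlet_energy c F"
    using hz by (simp only: mult.assoc[symmetric] ennreal_mult[symmetric, of 2 "h z / 2"]) simp
  also have "\<dots> \<le> ennreal (potential UNIV z z) * dirichlet_energy c F"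
    unfolding h_def by (intro mult_right_mono ennreal_leI potential_mono pole green_pole) auto
  finally show ?thesis by simp
qed

end

lemma green_infinite_if_vanishing_capacity:
  assumes sym: "\<And>x y. c x y = c y x" and pole: "0 < p z" and cap: "vanishing_capacity c z"
  shows "green walk UNIV z z = \<infinity>"
proof (rule ccontr)
  assume "green walk UNIV z z \<noteq> \<infinity>"
  then have fin: "green walk UNIV z z < \<infinity>" by (simp add: less_top)
  let ?h = "potential UNIV z z"
  obtain F where F: "test_function z F" "dirichlet_energy c F < ennreal (1 / (?h + 1))"
    using cap potential_nonneg[of UNIV z z]
    unfolding vanishing_capacity_def by (metis add_nonneg_pos ennreal_less_zero_iff zero_less_divide_1_iff zero_less_one)
  have "2 \<le> ennreal ?h * dirichlet_energy c F"
    by (rule test_function_energy_ge[OF pole fin sym F(1)])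
  also have "\<dots> \<le> ennreal ?h * ennreal (1 / (?h + 1))"
    using F(2) by (intro mult_left_mono) auto
  also have "\<dots> = ennreal (?h / (?h + 1))"
    using potential_nonneg[of UNIV z z] by (simp add: ennreal_mult[symmetric])
  also have "\<dots> \<le> ennreal 1"
    using potential_nonneg[of UNIV z z] by (intro ennreal_leI) (simp add: field_simps)
  finally show False by simp
qed

end

section \<open>Visits and crossings of a Markov chain\<close>

abbreviation transition :: "('v \<Rightarrow> 'v pmf) \<Rightarrow> 'v \<Rightarrow> 'v \<Rightarrow> ennreal" where
  "transition K x y \<equiv> ennreal (pmf (K x) y)"

context
  fixes M :: "'w measure" and K :: "'v::countable \<Rightarrow> 'v pmf" and s X
  assumes chain: "markov_chain M K s X"
begin

lemma chain_prob_space: "prob_space M"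
  using chain by (simp add: markov_chain_def)

lemma chain_measurable [measurable]: "X n \<in> M \<rightarrow>\<^sub>M count_space UNIV"
  using chain by (simp add: markov_chain_def)

lemma chain_start: "AE \<omega> in M. X 0 \<omega> = s"
  using chain by (simp add: markov_chain_def)

lemma chain_cylinder:
  "emeasure M {\<omega> \<in> space M. \<forall>i\<le>Suc n. X i \<omega> = x i} =
     emeasure M {\<omega> \<in> space M. \<forall>i\<le>n. X i \<omega> = x i} * transition K (x n) (x (Suc n))"
proof -
  interpret prob_space M by (rule chain_prob_space)
  show ?thesis
    using chain by (simp add: emeasure_eq_measure markov_chain_def ennreal_mult[symmetric])
qed

text \<open>
  The history up to time \<open>n\<close> is a list over a countable type, so every event of the past is a countable disjoint union
  of cylinders.
\<close>

lemma markov_property: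
  "emeasure M {\<omega> \<in> space M. Q (map (\<lambda>i. X i \<omega>) [0..<Suc n]) \<and> X n \<omega> = x \<and> X (Suc n) \<omega> = y} =
     emeasure M {\<omega> \<in> space M. Q (map (\<lambda>i. X i \<omega>) [0..<Suc n]) \<and> X n \<omega> = x} * transition K x y"
proof -
  define H where "H \<omega> = map (\<lambda>i. X i \<omega>) [0..<Suc n]" for \<omega>
  let ?E = "\<lambda>h. {\<omega> \<in> space M. H \<omega> = h}"
  let ?E' = "\<lambda>h. {\<omega> \<in> space M. H \<omega> = h \<and> X (Suc n) \<omega> = y}"
  define L where "L = {h. length h = Suc n \<and> Q h \<and> h ! n = x}"
  have nth: "H \<omega> ! n = X n \<omega>" "length (H \<omega>) = Suc n" for \<omega>
    by (simp_all add: H_def del: upt_Suc)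
  have hist: "H \<omega> = h \<longleftrightarrow> (\<forall>i\<le>n. X i \<omega> = h ! i)" if "h \<in> L" for h \<omega>
    using that by (auto simp: L_def H_def list_eq_iff_nth_eq less_Suc_eq_le simp del: upt_Suc)
  have sets: "?E h \<in> sets M" "?E' h \<in> sets M" if "h \<in> L" for h
    unfolding hist[OF that] by measurable
  have "{\<omega> \<in> space M. Q (H \<omega>) \<and> X n \<omega> = x} = (\<Union>h\<in>L. ?E h)"
    using nth by (auto simp: L_def)
  moreover have "emeasure M (\<Union>h\<in>L. ?E h) = (\<integral>\<^sup>+h. emeasure M (?E h) \<partial>count_space L)"
    using sets by (intro emeasure_UN_countable) (auto simp: disjoint_family_on_def)
  ultimately have 1: "emeasure M {\<omega> \<in> space M. Q (H \<omega>) \<and> X n \<omega> = x} =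
    (\<integral>\<^sup>+h. emeasure M (?E h) \<partial>count_space L)" by simp
  have "{\<omega> \<in> space M. Q (H \<omega>) \<and> X n \<omega> = x \<and> X (Suc n) \<omega> = y} = (\<Union>h\<in>L. ?E' h)"
    using nth by (auto simp: L_def)
  moreover have "emeasure M (\<Union>h\<in>L. ?E' h) = (\<integral>\<^sup>+h. emeasure M (?E' h) \<partial>count_space L)"
    using sets by (intro emeasure_UN_countable) (auto simp: disjoint_family_on_def)
  moreover have "emeasure M (?E' h) = emeasure M (?E h) * transition K x y" if "h \<in> L" for h
  proof -
    have 2: "(\<forall>i\<le>n. X i \<omega> = (h @ [y]) ! i) \<longleftrightarrow> H \<omega> = h" for \<omega>
      unfolding hist[OF that] using that by (auto simp: L_def nth_append)
    have 3: "(\<forall>i\<le>Suc n. X i \<omega> = (h @ [y]) ! i) \<longleftrightarrow> H \<omega> = h \<and> X (Suc n) \<omega> = y" for \<omega>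
      unfolding 2[symmetric] using that by (auto simp: L_def nth_append le_Suc_eq)
    have "(h @ [y]) ! n = x" "(h @ [y]) ! Suc n = y"
      using that by (auto simp: L_def nth_append)
    then show ?thesis
      using chain_cylinder[of n "\<lambda>i. (h @ [y]) ! i"] unfolding 2 3 by simp
  qed
  then have "(\<integral>\<^sup>+h. emeasure M (?E' h) \<partial>count_space L) = (\<integral>\<^sup>+h. emeasure M (?E h) * transition K x y \<partial>count_space L)"
    by (intro nn_integral_cong) simp
  ultimately show ?thesis
    by (simp only: H_def[symmetric] 1 nn_integral_multc borel_measurable_count_space)
qed

lemma emeasure_excursion:
  "emeasure M {\<omega> \<in> space M. X n \<omega> = z \<and> (\<forall>i\<in>{1..m}. X (n + i) \<omega> \<in> A) \<and> X (n + m) \<omega> = y} =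
     emeasure M {\<omega> \<in> space M. X n \<omega> = z} * killed_step (transition K) A z m y"
proof (induction m arbitrary: y)
  case 0
  have "{\<omega> \<in> space M. X n \<omega> = z \<and> X n \<omega> = y} = (if y = z then {\<omega> \<in> space M. X n \<omega> = z} else {})"
    by auto
  then show ?case by (auto split: split_indicator)
next
  case (Suc m)
  define Q where "Q h \<longleftrightarrow> h ! n = z \<and> (\<forall>i\<in>{1..m}. h ! (n + i) \<in> A)" for h
  have Q: "Q (map (\<lambda>i. X i \<omega>) [0..<Suc (n + m)]) \<longleftrightarrow> X n \<omega> = z \<and> (\<forall>i\<in>{1..m}. X (n + i) \<omega> \<in> A)" for \<omega>
    by (auto simp: Q_def simp del: upt_Suc)
  let ?E = "\<lambda>x. {\<omega> \<in> space M. Q (map (\<lambda>i. X i \<omega>) [0..<Suc (n + m)]) \<and> X (n + m) \<omega> = x \<and> X (Suc (n + m)) \<omega> = y}"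
  show ?case
  proof (cases "y \<in> A")
    case True
    have "{\<omega> \<in> space M. X n \<omega> = z \<and> (\<forall>i\<in>{1..Suc m}. X (n + i) \<omega> \<in> A) \<and> X (n + Suc m) \<omega> = y} = (\<Union>x. ?E x)"
      using True by (auto simp: Q le_Suc_eq atLeastAtMostSuc_conv simp del: upt_Suc)
    moreover have "emeasure M (\<Union>x. ?E x) = (\<integral>\<^sup>+x. emeasure M (?E x) \<partial>count_space UNIV)"
    proof (intro emeasure_UN_countable)
      show "?E x \<in> sets M" for x unfolding Q by measurable
    qed (auto simp: disjoint_family_on_def)
    moreover have "emeasure M (?E x) = emeasure M {\<omega> \<in> space M. X n \<omega> = z} * (killed_step (transition K) A z m x * transition K x y)" for x
      unfolding markov_property using Suc[of x] by (simp only: Q conj_assoc mult.assoc)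
    ultimately show ?thesis using True by (simp add: nn_integral_cmult)
  next
    case False
    then have "{\<omega> \<in> space M. X n \<omega> = z \<and> (\<forall>i\<in>{1..Suc m}. X (n + i) \<omega> \<in> A) \<and> X (n + Suc m) \<omega> = y} = {}"
      by (auto intro!: bexI[of _ "Suc m"])
    then show ?thesis using False by (simp only: emeasure_empty killed_step.simps) simp
  qed
qed

lemma emeasure_chain_at:
  "emeasure M {\<omega> \<in> space M. X m \<omega> = y} = killed_step (transition K) UNIV s m y"
proof -
  interpret prob_space M by (rule chain_prob_space)
  have "emeasure M {\<omega> \<in> space M. X m \<omega> = y} =
    emeasure M {\<omega> \<in> space M. X 0 \<omega> = s \<and> (\<forall>i\<in>{1..m}. X (0 + i) \<omega> \<in> UNIV) \<and> X (0 + m) \<omega> = y}"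
    by (intro emeasure_eq_AE eventually_mono[OF chain_start]) auto
  also have "\<dots> = emeasure M {\<omega> \<in> space M. X 0 \<omega> = s} * killed_step (transition K) UNIV s m y"
    by (rule emeasure_excursion)
  also have "emeasure M {\<omega> \<in> space M. X 0 \<omega> = s} = 1"
    using chain_start by (intro emeasure_eq_1_AE) auto
  finally show ?thesis by simp
qed

lemma emeasure_chain_step:
  "emeasure M {\<omega> \<in> space M. X m \<omega> = x \<and> X (Suc m) \<omega> = y} =
     killed_step (transition K) UNIV s m x * transition K x y"
  using markov_property[of "\<lambda>_. True" m x y] by (simp add: emeasure_chain_at)

lemma visits_eq_suminf:
  "emeasure (count_space UNIV) {n. x n = y} = (\<Sum>n. indicator {n. x n = y} n)"
  by (subst nn_integral_indicator[symmetric], simp, subst nn_integral_count_space_nat, simp)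

lemma visits_measurable: "(\<lambda>\<omega>. emeasure (count_space UNIV) {n. X n \<omega> = y}) \<in> borel_measurable M"
  unfolding visits_eq_suminf indicator_def mem_Collect_eq by measurable

lemma expected_visits:
  "(\<integral>\<^sup>+\<omega>. emeasure (count_space UNIV) {n. X n \<omega> = y} \<partial>M) = green (transition K) UNIV s y"
proof -
  have "(\<integral>\<^sup>+\<omega>. emeasure (count_space UNIV) {n. X n \<omega> = y} \<partial>M) =
      (\<integral>\<^sup>+\<omega>. (\<Sum>n. indicator {\<omega> \<in> space M. X n \<omega> = y} \<omega>) \<partial>M)"
    unfolding visits_eq_suminf by (intro nn_integral_cong suminf_cong) (auto split: split_indicator)
  also have "\<dots> = (\<Sum>n. emeasure M {\<omega> \<in> space M. X n \<omega> = y})"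
    by (subst nn_integral_suminf) auto
  finally show ?thesis by (simp add: emeasure_chain_at green_def)
qed

text \<open>
  Last-exit decomposition. The event that \<open>n\<close> is the time of the last visit to \<open>s\<close> has probability \<open>P(X\<^sub>n = s)\<close> times the
  escape probability. These events are disjoint and the probabilities \<open>P(X\<^sub>n = s)\<close> have an infinite sum, so the escape
  probability is 0 and almost surely no visit is the last one.
\<close>

lemma recurrent_if_green_infinite:
  assumes inf: "green (transition K) UNIV s s = \<infinity>"
  shows "recurrent_process M X"
proof -
  interpret prob_space M by (rule chain_prob_space)
  define E where "E n m = {\<omega> \<in> space M. X n \<omega> = s \<and> (\<forall>i\<in>{1..m}. X (n + i) \<omega> \<in> - {s})}" for n m
  \<comment> \<open>\<open>E n m\<close>: at \<open>s\<close> at time \<open>n\<close> and away from \<open>s\<close> during the next \<open>m\<close> steps. Given the former, the latter has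
    probability \<open>\<rho> m\<close>.\<close>
  define \<rho> where "\<rho> m = (\<integral>\<^sup>+y. killed_step (transition K) (- {s}) s m y \<partial>count_space UNIV)" for m
  have E_sets [measurable]: "E n m \<in> sets M" for n m unfolding E_def by measurable
  have E: "emeasure M (E n m) = killed_step (transition K) UNIV s n s * \<rho> m" for n m
  proof -
    have "E n m = (\<Union>y. {\<omega> \<in> space M. X n \<omega> = s \<and> (\<forall>i\<in>{1..m}. X (n + i) \<omega> \<in> - {s}) \<and> X (n + m) \<omega> = y})"
      by (auto simp: E_def)
    also have "emeasure M \<dots> = (\<integral>\<^sup>+y. emeasure M {\<omega> \<in> space M. X n \<omega> = s \<and>
        (\<forall>i\<in>{1..m}. X (n + i) \<omega> \<in> - {s}) \<and> X (n + m) \<omega> = y} \<partial>count_space UNIV)"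
      by (intro emeasure_UN_countable) (auto simp: disjoint_family_on_def)
    finally show ?thesis
      by (simp only: emeasure_excursion emeasure_chain_at \<rho>_def nn_integral_cmult borel_measurable_count_space)
  qed
  define B where "B n = (\<Inter>m. E n m)" for n
  have B_sets [measurable]: "B n \<in> sets M" for n unfolding B_def by measurable
  have "decseq (E n)" for n by (auto simp: E_def decseq_def)
  then have B: "emeasure M (B n) = (INF m. emeasure M (E n m))" for n
    unfolding B_def by (intro INF_emeasure_decseq[symmetric]) auto
  have B_iff: "\<omega> \<in> B n \<longleftrightarrow> \<omega> \<in> space M \<and> X n \<omega> = s \<and> (\<forall>i\<ge>1. X (n + i) \<omega> \<noteq> s)" for n \<omega>
    by (auto simp: B_def E_def) (metis atLeastAtMost_iff order_refl)
  have disj: "disjoint_family B"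
    unfolding disjoint_family_on_def
  proof safe
    fix m n \<omega> assume mn: "m \<noteq> n" and \<omega>: "\<omega> \<in> B m" "\<omega> \<in> B n"
    have False if "m < n" "\<omega> \<in> B m" "\<omega> \<in> B n" for m n
      using that unfolding B_iff by (auto dest: spec[of _ "n - m"])
    from this[of m n] this[of n m] show "\<omega> \<in> {}" using mn \<omega> by force
  qed
  let ?r = "INF m. \<rho> m"
  have "green (transition K) UNIV s s * ?r = (\<Sum>n. killed_step (transition K) UNIV s n s * ?r)"
    by (simp add: green_def)
  also have "\<dots> \<le> (\<Sum>n. emeasure M (B n))"
    unfolding B E by (intro suminf_le summableI INF_greatest mult_left_mono INF_lower) auto
  also have "\<dots> = emeasure M (\<Union>n. B n)"
    using disj by (intro suminf_emeasure) auto
  also have "\<dots> \<le> 1" by (rule emeasure_le_1)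
  finally have r: "?r = 0"
    using inf by (cases "?r = 0") (auto simp: ennreal_top_mult top_unique)
  have "emeasure M (B n) = 0" for n
  proof -
    have "emeasure M (B n) \<le> ?r"
    proof (rule INF_greatest)
      fix m
      have "emeasure M (B n) \<le> emeasure M (E n m)" unfolding B by (rule INF_lower) simp
      also have "\<dots> \<le> 1 * \<rho> m"
        unfolding E emeasure_chain_at[symmetric] by (intro mult_right_mono emeasure_le_1) auto
      finally show "emeasure M (B n) \<le> \<rho> m" by simp
    qed
    then show ?thesis using r by simp
  qed
  then have "AE \<omega> in M. \<forall>n. \<omega> \<notin> B n"
    unfolding AE_all_countable by (intro allI AE_not_in) (auto simp: null_sets_def)
  then show ?thesis
    unfolding recurrent_process_def using chain_start AE_space
  proof eventually_elim
    case (elim \<omega>)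
    show "\<exists>\<^sub>\<infinity>n. X n \<omega> = X 0 \<omega>"
    proof (rule ccontr)
      assume "\<not> (\<exists>\<^sub>\<infinity>n. X n \<omega> = X 0 \<omega>)"
      then have fin: "finite {n. X n \<omega> = s}" using elim by (simp add: INFM_iff_infinite)
      let ?n = "Max {n. X n \<omega> = s}"
      have "?n \<in> {n. X n \<omega> = s}" using fin elim by (intro Max_in) auto
      moreover have "X (?n + i) \<omega> \<noteq> s" if "1 \<le> i" for i
      proof
        assume "X (?n + i) \<omega> = s"
        then have "?n + i \<le> ?n" using fin by (intro Max_ge) auto
        then show False using that by simp
      qed
      ultimately have "\<omega> \<in> B ?n" using elim by (auto simp: B_iff)
      then show False using elim by blast
    qed
  qed
qed

lemma crossings_eq_suminf:
  "crossings x u v = (\<Sum>n. indicator {n. {x n, x (Suc n)} = {u, v}} n)"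
  unfolding crossings_def
  by (subst nn_integral_indicator[symmetric], simp, subst nn_integral_count_space_nat, simp)

lemma crossings_measurable [measurable]: "(\<lambda>\<omega>. crossings (\<lambda>n. X n \<omega>) u v) \<in> borel_measurable M"
  unfolding crossings_eq_suminf indicator_def mem_Collect_eq doubleton_eq_iff by measurable

lemma expected_crossings_eq_suminf:
  "(\<integral>\<^sup>+\<omega>. crossings (\<lambda>n. X n \<omega>) u v \<partial>M) =
     (\<Sum>n. emeasure M {\<omega> \<in> space M. {X n \<omega>, X (Suc n) \<omega>} = {u, v}})"
proof -
  have [measurable]: "{\<omega> \<in> space M. {X n \<omega>, X (Suc n) \<omega>} = {u, v}} \<in> sets M" for n
    unfolding doubleton_eq_iff by measurable
  have "(\<integral>\<^sup>+\<omega>. crossings (\<lambda>n. X n \<omega>) u v \<partial>M) =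
      (\<integral>\<^sup>+\<omega>. (\<Sum>n. indicator {\<omega> \<in> space M. {X n \<omega>, X (Suc n) \<omega>} = {u, v}} \<omega>) \<partial>M)"
    unfolding crossings_eq_suminf by (intro nn_integral_cong suminf_cong) (auto split: split_indicator)
  also have "\<dots> = (\<Sum>n. emeasure M {\<omega> \<in> space M. {X n \<omega>, X (Suc n) \<omega>} = {u, v}})"
    by (subst nn_integral_suminf) auto
  finally show ?thesis .
qed

text \<open>
  The crossings from \<open>v\<close> to \<open>u\<close> are left out here, and the upper bound below counts the crossings of a loop
  twice. The two bounds spare a case distinction between loops and other edges.
\<close>

lemma expected_crossings_ge:
  "green (transition K) UNIV s u * transition K u v \<le> (\<integral>\<^sup>+\<omega>. crossings (\<lambda>n. X n \<omega>) u v \<partial>M)"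
proof -
  have "green (transition K) UNIV s u * transition K u v =
      (\<Sum>n. emeasure M {\<omega> \<in> space M. X n \<omega> = u \<and> X (Suc n) \<omega> = v})"
    by (simp add: emeasure_chain_step green_def)
  also have "\<dots> \<le> (\<Sum>n. emeasure M {\<omega> \<in> space M. {X n \<omega>, X (Suc n) \<omega>} = {u, v}})"
    unfolding doubleton_eq_iff by (intro suminf_le summableI emeasure_mono) (auto, measurable)
  finally show ?thesis by (simp add: expected_crossings_eq_suminf)
qed

lemma expected_crossings_le:
  "(\<integral>\<^sup>+\<omega>. crossings (\<lambda>n. X n \<omega>) u v \<partial>M) \<le>
     green (transition K) UNIV s u * transition K u v + green (transition K) UNIV s v * transition K v u"
proof -
  have "(\<integral>\<^sup>+\<omega>. crossings (\<lambda>n. X n \<omega>) u v \<partial>M) \<le>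
      (\<Sum>n. emeasure M {\<omega> \<in> space M. X n \<omega> = u \<and> X (Suc n) \<omega> = v} +
           emeasure M {\<omega> \<in> space M. X n \<omega> = v \<and> X (Suc n) \<omega> = u})"
    unfolding expected_crossings_eq_suminf
  proof (intro suminf_le summableI)
    fix n
    have "{\<omega> \<in> space M. {X n \<omega>, X (Suc n) \<omega>} = {u, v}} =
      {\<omega> \<in> space M. X n \<omega> = u \<and> X (Suc n) \<omega> = v} \<union> {\<omega> \<in> space M. X n \<omega> = v \<and> X (Suc n) \<omega> = u}"
      by (auto simp: doubleton_eq_iff)
    then show "emeasure M {\<omega> \<in> space M. {X n \<omega>, X (Suc n) \<omega>} = {u, v}} \<le>
      emeasure M {\<omega> \<in> space M. X n \<omega> = u \<and> X (Suc n) \<omega> = v} + emeasure M {\<omega> \<in> space M. X n \<omega> = v \<and> X (Suc n) \<omega> = u}"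
      by (simp only:) (intro emeasure_subadditive; measurable)
  qed
  also have "\<dots> = (\<Sum>n. killed_step (transition K) UNIV s n u * transition K u v) +
      (\<Sum>n. killed_step (transition K) UNIV s n v * transition K v u)"
    unfolding emeasure_chain_step by (intro suminf_add[symmetric] summableI)
  finally show ?thesis by (simp add: green_def)
qed

end

section \<open>Networks of crossings\<close>

lemma dirichlet_energy_add:
  "dirichlet_energy (\<lambda>x y. w x y + w' x y) F = dirichlet_energy w F + dirichlet_energy w' F"
  unfolding dirichlet_energy_def
  by (subst nn_integral_add[symmetric]) (auto intro!: nn_integral_cong simp: distrib_right)

lemma dirichlet_energy_flip:
  fixes w :: "'v \<Rightarrow> 'v \<Rightarrow> ennreal"
  shows "dirichlet_energy (\<lambda>x y. w y x) F = dirichlet_energy w F"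
proof -
  have "dirichlet_energy (\<lambda>x y. w y x) F =
      (\<integral>\<^sup>+x. \<integral>\<^sup>+y. w y x * ennreal ((F x - F y)\<^sup>2) \<partial>count_space UNIV \<partial>count_space UNIV)"
    unfolding dirichlet_energy_def by (rule nn_integral_pair_count_space(1))
  also have "\<dots> = (\<integral>\<^sup>+x. \<integral>\<^sup>+y. w y x * ennreal ((F y - F x)\<^sup>2) \<partial>count_space UNIV \<partial>count_space UNIV)"
    by (simp add: power2_commute)
  also have "\<dots> = dirichlet_energy w F"
    unfolding dirichlet_energy_def by (rule nn_integral_pair_count_space(2)[symmetric])
  finally show ?thesis .
qed

lemma vanishing_capacity_mono:
  assumes "vanishing_capacity w t" "\<And>x y. w' x y \<le> w x y"
  shows "vanishing_capacity w' t"
  unfolding vanishing_capacity_def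
proof (intro allI impI)
  fix e :: ennreal assume "0 < e"
  then obtain F where "test_function t F" "dirichlet_energy w F < e"
    using assms(1) by (auto simp: vanishing_capacity_def)
  moreover have "dirichlet_energy w' F \<le> dirichlet_energy w F"
    by (intro dirichlet_energy_mono assms(2))
  ultimately show "\<exists>F. test_function t F \<and> dirichlet_energy w' F < e"
    by (meson le_less_trans)
qed

lemma vanishing_capacity_symmetrize:
  assumes "vanishing_capacity w t"
  shows "vanishing_capacity (\<lambda>x y. w x y + w y x) t"
  unfolding vanishing_capacity_def
proof (intro allI impI)
  fix e :: ennreal assume "0 < e"
  then have "0 < e / 2" by (simp add: ennreal_zero_less_divide)
  then obtain F where F: "test_function t F" "dirichlet_energy w F < e / 2"
    using assms by (auto simp: vanishing_capacity_def)
  have "dirichlet_energy (\<lambda>x y. w x y + w y x) F = dirichlet_energy w F + dirichlet_energy w F"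
    by (simp only: dirichlet_energy_add dirichlet_energy_flip[of w])
  also have "\<dots> < e / 2 + e / 2"
    by (intro add_strict_mono F)
  also have "\<dots> = e"
    by (rule ennreal_half_plus_half)
  finally show "\<exists>F. test_function t F \<and> dirichlet_energy (\<lambda>x y. w x y + w y x) F < e"
    using F by blast
qed

context balanced_weights
begin

lemma killed_step_null: "0 < p z \<Longrightarrow> p x = 0 \<Longrightarrow> killed_step walk A z k x = 0"
proof (cases k)
  case (Suc j)
  assume "p x = 0"
  then have "c y x = 0" for y using c_le_in[of y x] by simp
  then show ?thesis by (simp add: Suc walk_def)
qed (auto split: split_indicator)

end

text \<open>
  The kernel of the random walk has no meaning at points of the type outside the graph, where the vertex weight
  is 0. The walk started in the graph never gets there, so its Green function is the one defined by
  the edge weights.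
\<close>

lemma recurrent_network_if_vanishing_capacity:
  fixes G :: "'v::countable ugraph"
  assumes net: "network G c" and conn: "connected_ugraph G"
    and pos: "\<And>v. v \<in> vertices G \<Longrightarrow> 0 < vertex_weight c v"
    and cap: "\<And>v. v \<in> vertices G \<Longrightarrow> vanishing_capacity c v"
  shows "recurrent_network G c"
proof -
  let ?p = "vertex_weight c"
  have sym: "c u v = c v u" for u v using net by (simp add: network_def)
  have fin: "?p v < \<infinity>" for v
  proof (cases "v \<in> vertices G")
    case True then show ?thesis using net by (simp add: network_def)
  next
    case False
    have "c v u = 0" for u
    proof -
      have "{v, u} \<notin> edges G"
        using net False by (auto simp: network_def wf_ugraph_def doubleton_eq_iff)
      then show ?thesis using net unfolding network_def by blast
    qed
    then show ?thesis by (simp add: vertex_weight_def)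
  qed
  interpret balanced_weights c ?p
  proof
    show "(\<integral>\<^sup>+x. c x y \<partial>count_space UNIV) = ?p y" for y
      unfolding vertex_weight_def by (subst sym) simp
  qed (use fin in \<open>simp_all add: vertex_weight_def\<close>)
  have kernel: "transition (walk_kernel c) x y = walk x y" if "0 < ?p x" for x y
  proof -
    have "c x y / ?p x < \<infinity>"
      using that c_le_in[of x y] fin[of y] by (auto simp: ennreal_divide_eq_top_iff less_top[symmetric] top_unique)
    then show ?thesis
      by (simp add: pmf_walk_kernel[OF that fin] walk_def)
  qed
  have "recurrent_process (chain_law (walk_kernel c) v) (\<lambda>n \<omega>. \<omega> n)" if v: "v \<in> vertices G" for v
  proof (rule recurrent_if_green_infinite[OF markov_chain_chain_law])
    have "killed_step (transition (walk_kernel c)) UNIV v k y = killed_step walk UNIV v k y" for k y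
    proof (induction k arbitrary: y)
      case (Suc k)
      have "killed_step walk UNIV v k x * transition (walk_kernel c) x y = killed_step walk UNIV v k x * walk x y" for x
        using killed_step_null[OF pos[OF v], of x UNIV k] kernel[of x y]
        by (cases "?p x = 0") (auto simp: zero_less_iff_neq_zero)
      then show ?case by (simp add: Suc)
    qed simp
    then have "green (transition (walk_kernel c)) UNIV v v = green walk UNIV v v"
      by (simp add: green_def)
    then show "green (transition (walk_kernel c)) UNIV v v = \<infinity>"
      using green_infinite_if_vanishing_capacity[OF sym pos[OF v] cap[OF v]] by simp
  qed
  then show ?thesis using net conn pos by (simp add: recurrent_network_def)
qed

lemma nn_integral_transition: "(\<integral>\<^sup>+y. transition K x y \<partial>count_space UNIV) = 1"
  using measure_pmf.emeasure_space_1[of "K x"] by (simp add: nn_integral_pmf)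

lemma killed_step_eq_n_step:
  "killed_step (transition K) UNIV x n y = ennreal (pmf (n_step K n x) y)"
proof (induction n arbitrary: y)
  case 0
  show ?case by (auto simp: n_step_def split: split_indicator)
next
  case (Suc n)
  have "ennreal (pmf (n_step K (Suc n) x) y) = (\<integral>\<^sup>+u. transition K u y \<partial>measure_pmf (n_step K n x))"
    by (simp add: n_step_def ennreal_pmf_bind)
  also have "\<dots> = (\<integral>\<^sup>+u. ennreal (pmf (n_step K n x) u) * transition K u y \<partial>count_space UNIV)"
    by (rule nn_integral_measure_pmf)
  finally show ?case by (simp add: Suc)
qed

lemma killed_step_trans:
  "killed_step P UNIV x m u * killed_step P UNIV u n y \<le> killed_step P UNIV x (m + n) y"
proof (induction n arbitrary: y)
  case (Suc n)
  have "killed_step P UNIV x m u * killed_step P UNIV u (Suc n) y =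
      (\<integral>\<^sup>+w. killed_step P UNIV x m u * killed_step P UNIV u n w * P w y \<partial>count_space UNIV)"
    by (simp add: nn_integral_cmult mult.assoc)
  also have "\<dots> \<le> (\<integral>\<^sup>+w. killed_step P UNIV x (m + n) w * P w y \<partial>count_space UNIV)"
    by (intro nn_integral_mono mult_right_mono Suc) auto
  finally show ?case by simp
qed (auto split: split_indicator)

lemma irreducible_step_pos:
  assumes "irreducible_kernel K"
  obtains n where "0 < killed_step (transition K) UNIV x n y"
  using assms unfolding irreducible_kernel_def killed_step_eq_n_step by auto

lemma green_pos:
  assumes "irreducible_kernel K"
  shows "0 < green (transition K) UNIV x y"
proof -
  obtain n where n: "0 < killed_step (transition K) UNIV x n y"
    by (rule irreducible_step_pos[OF assms])
  have "(\<Sum>k\<in>{n}. killed_step (transition K) UNIV x k y) \<le> green (transition K) UNIV x y"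
    unfolding green_def by (intro sum_le_suminf summableI) auto
  then show ?thesis using n by simp
qed

text \<open>
  Prepending a path from \<open>s\<close> to \<open>x\<close> and appending one from \<open>y\<close> to \<open>s\<close> compares the visits to \<open>y\<close> from \<open>x\<close> with the
  visits to \<open>s\<close> from \<open>s\<close>.
\<close>

lemma green_finite_if_irreducible:
  assumes irr: "irreducible_kernel K" and fin: "green (transition K) UNIV s s < \<infinity>"
  shows "green (transition K) UNIV x y < \<infinity>"
proof -
  let ?q = "killed_step (transition K) UNIV"
  obtain i j where ij: "0 < ?q s i x" "0 < ?q y j s"
    by (metis irr irreducible_step_pos)
  have "?q s i x * (green (transition K) UNIV x y * ?q y j s) = (\<Sum>n. ?q s i x * (?q x n y * ?q y j s))"
    by (simp add: green_def)
  also have "\<dots> \<le> green (transition K) UNIV s s"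
  proof (intro suminf_le_const summableI)
    fix m
    have "(\<Sum>n<m. ?q s i x * (?q x n y * ?q y j s)) \<le> (\<Sum>n<m. ?q s (i + (n + j)) s)"
    proof (rule sum_mono)
      fix n
      have "?q s i x * (?q x n y * ?q y j s) \<le> ?q s i x * ?q x (n + j) s"
        by (intro mult_left_mono killed_step_trans) auto
      also have "\<dots> \<le> ?q s (i + (n + j)) s" by (rule killed_step_trans)
      finally show "?q s i x * (?q x n y * ?q y j s) \<le> ?q s (i + (n + j)) s" .
    qed
    also have "\<dots> = (\<Sum>k\<in>(\<lambda>n. i + (n + j)) ` {..<m}. ?q s k s)"
      by (subst sum.reindex) (auto simp: inj_on_def)
    also have "\<dots> \<le> green (transition K) UNIV s s"
      unfolding green_def by (intro sum_le_suminf summableI) auto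
    finally show "(\<Sum>n<m. ?q s i x * (?q x n y * ?q y j s)) \<le> green (transition K) UNIV s s" .
  qed
  finally show ?thesis
    using ij fin by (auto simp: ennreal_mult_eq_top_iff less_top[symmetric] top_unique)
qed

lemma vanishing_capacity_green_flow:
  fixes K :: "'v::countable \<Rightarrow> 'v pmf"
  assumes "irreducible_kernel K" and "stationary_measure K \<pi>"
    and fin: "green (transition K) UNIV z z < \<infinity>"
  shows "vanishing_capacity (\<lambda>x y. green (transition K) UNIV z x * transition K x y) t"
proof -
  have \<pi>: "0 < \<pi> x" "\<pi> x < \<infinity>"
    "(\<integral>\<^sup>+x. \<pi> x * transition K x y \<partial>count_space UNIV) = \<pi> y" for x y
    using assms(2) by (auto simp: stationary_measure_def)
  interpret balanced_weights "\<lambda>x y. \<pi> x * transition K x y" \<pi>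
    by unfold_locales (use \<pi> in \<open>simp_all add: nn_integral_cmult nn_integral_transition\<close>)
  have "walk x y = transition K x y" for x y
  proof -
    have "walk x y = transition K x y * (\<pi> x / \<pi> x)"
      by (simp add: walk_def divide_ennreal_def mult_ac)
    also have "\<pi> x / \<pi> x = 1"
      using \<pi>(1,2)[of x] by (intro ennreal_divide_self) auto
    finally show ?thesis by simp
  qed
  then have walk: "walk = transition K" by (simp add: fun_eq_iff)
  show ?thesis
    using vanishing_capacity_of_crossing_weights[OF \<pi>(1), of z t] fin green_pos[OF assms(1)]
    unfolding walk by blast
qed

lemma crossings_commute: "crossings x u v = crossings x v u"
  by (simp add: crossings_def insert_commute)

context
  fixes M :: "'w measure" and K :: "'v::countable \<Rightarrow> 'v pmf" and s X
  assumes chain: "markov_chain M K s X"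
begin

lemma energy_density_measurable:
  "(\<lambda>(\<omega>, e). crossings (\<lambda>n. X n \<omega>) (fst e) (snd e) * ennreal ((F (fst e) - F (snd e))\<^sup>2))
     \<in> borel_measurable (M \<Otimes>\<^sub>M count_space UNIV)"
proof -
  note [measurable] = crossings_measurable[OF chain]
  have "(\<lambda>(e, \<omega>). crossings (\<lambda>n. X n \<omega>) (fst e) (snd e) * ennreal ((F (fst e) - F (snd e))\<^sup>2))
     \<in> borel_measurable (count_space UNIV \<Otimes>\<^sub>M M)"
    by (intro measurable_pair_measure_countable1) auto
  from measurable_pair_swap[OF this] show ?thesis by simp
qed

lemma energy_measurable:
  "(\<lambda>\<omega>. dirichlet_energy (crossings (\<lambda>n. X n \<omega>)) F) \<in> borel_measurable M"
proof -
  interpret sigma_finite_measure "count_space (UNIV :: ('v \<times> 'v) set)"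
    by (rule sigma_finite_measure_count_space)
  show ?thesis
    unfolding dirichlet_energy_def split_def
    using energy_density_measurable by (rule borel_measurable_nn_integral)
qed

lemma expected_energy:
  "(\<integral>\<^sup>+\<omega>. dirichlet_energy (crossings (\<lambda>n. X n \<omega>)) F \<partial>M) =
     dirichlet_energy (\<lambda>u v. \<integral>\<^sup>+\<omega>. crossings (\<lambda>n. X n \<omega>) u v \<partial>M) F"
proof -
  note [measurable] = crossings_measurable[OF chain]
  interpret prob_space M by (rule chain_prob_space[OF chain])
  interpret count: sigma_finite_measure "count_space (UNIV :: ('v \<times> 'v) set)"
    by (rule sigma_finite_measure_count_space)
  interpret pair_sigma_finite M "count_space (UNIV :: ('v \<times> 'v) set)" ..
  from Fubini'[OF energy_density_measurable[of F]] show ?thesis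
    by (simp add: dirichlet_energy_def split_def nn_integral_multc)
qed

lemma vanishing_capacity_expected_crossings:
  assumes "vanishing_capacity (\<lambda>x y. green (transition K) UNIV s x * transition K x y) t"
  shows "vanishing_capacity (\<lambda>u v. \<integral>\<^sup>+\<omega>. crossings (\<lambda>n. X n \<omega>) u v \<partial>M) t"
  by (rule vanishing_capacity_mono[OF vanishing_capacity_symmetrize[OF assms] expected_crossings_le[OF chain]])

text \<open>
  Test functions chosen for the expected weights, with summable energies, also work for almost every realisation.
\<close>

lemma AE_vanishing_capacity_crossings:
  assumes "vanishing_capacity (\<lambda>u v. \<integral>\<^sup>+\<omega>. crossings (\<lambda>n. X n \<omega>) u v \<partial>M) t"
  shows "AE \<omega> in M. vanishing_capacity (crossings (\<lambda>n. X n \<omega>)) t"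
proof -
  note [measurable] = crossings_measurable[OF chain]
  let ?w = "\<lambda>u v. \<integral>\<^sup>+\<omega>. crossings (\<lambda>n. X n \<omega>) u v \<partial>M"
  let ?E = "\<lambda>\<omega>. dirichlet_energy (crossings (\<lambda>n. X n \<omega>))"
  have "\<exists>F. test_function t F \<and> dirichlet_energy ?w F < ennreal ((1 / 2) ^ m)" for m :: nat
    using assms by (simp add: vanishing_capacity_def)
  then obtain F where F: "\<And>m. test_function t (F m)" "\<And>m. dirichlet_energy ?w (F m) < ennreal ((1 / 2) ^ m)"
    by metis
  note [measurable] = energy_measurable
  have "(\<integral>\<^sup>+\<omega>. (\<Sum>m. ?E \<omega> (F m)) \<partial>M) = (\<Sum>m. dirichlet_energy ?w (F m))"
    by (simp add: nn_integral_suminf expected_energy)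
  also have "\<dots> \<le> (\<Sum>m. ennreal ((1 / 2) ^ m))"
    using F(2) by (intro suminf_le summableI) (auto intro: less_imp_le)
  also have "\<dots> = ennreal (\<Sum>m. (1 / 2) ^ m)"
    by (intro suminf_ennreal2 summable_geometric) auto
  also have "\<dots> < \<infinity>" by simp
  finally have "AE \<omega> in M. (\<Sum>m. ?E \<omega> (F m)) \<noteq> \<infinity>"
    by (intro nn_integral_PInf_AE) auto
  then show ?thesis
  proof eventually_elim
    case (elim \<omega>)
    have "\<exists>m. ?E \<omega> (F m) < e" if "0 < e" for e
    proof (rule ccontr)
      assume "\<not> (\<exists>m. ?E \<omega> (F m) < e)"
      then have "(\<Sum>m::nat. e) \<le> (\<Sum>m. ?E \<omega> (F m))"
        by (intro suminf_le summableI) (simp add: not_less)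
      moreover have "(\<Sum>m::nat. e) = \<infinity>"
        using that by (subst nn_integral_count_space_nat[symmetric]) (simp add: ennreal_mult_top)
      ultimately show False using elim by (simp add: top_unique)
    qed
    then show ?case using F(1) unfolding vanishing_capacity_def by blast
  qed
qed

end

lemma irreducible_induct:
  assumes irr: "irreducible_kernel K" and base: "S x"
    and step: "\<And>u v. S u \<Longrightarrow> 0 < pmf (K u) v \<Longrightarrow> S v"
  shows "S y"
proof -
  have "S y" if "y \<in> set_pmf (n_step K n x)" for n y
    using that
  proof (induction n arbitrary: y)
    case (Suc n)
    then obtain u where "u \<in> set_pmf (n_step K n x)" "y \<in> set_pmf (K u)"
      by (auto simp: n_step_def)
    then show ?case using Suc.IH step pmf_positive by metis
  qed (use base in \<open>auto simp: n_step_def\<close>)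
  then show ?thesis
    using irr unfolding irreducible_kernel_def by (metis pmf_positive_iff)
qed

lemma connected_transition_graph:
  assumes "irreducible_kernel K"
  shows "connected_ugraph (transition_graph K)"
  unfolding connected_ugraph_def
proof (intro ballI)
  fix u v
  let ?R = "{(x, y). {x, y} \<in> edges (transition_graph K)}\<^sup>*"
  show "(u, v) \<in> ?R"
  proof (rule irreducible_induct[OF assms, of "\<lambda>v. (u, v) \<in> ?R" u])
    fix x y assume "(u, x) \<in> ?R" and xy: "0 < pmf (K x) y"
    moreover have "{x, y} \<in> edges (transition_graph K)"
    proof -
      have "0 < pmf (K x) y + pmf (K y) x" using xy by (intro add_pos_nonneg) auto
      then show ?thesis unfolding transition_graph_def by auto
    qed
    ultimately show "(u, y) \<in> ?R" by (auto intro: rtrancl_into_rtrancl)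
  qed simp
qed

theorem recurrent_expected_crossings:
  fixes K :: "'v::countable \<Rightarrow> 'v pmf"
  assumes irr: "irreducible_kernel K" and stat: "stationary_measure K \<pi>"
    and fin: "\<And>y. green (transition K) UNIV z y < \<infinity>"
  shows "recurrent_network (transition_graph K) (expected_crossings K z)"
proof -
  let ?g = "green (transition K) UNIV z"
  let ?c = "expected_crossings K z"
  note chain = markov_chain_chain_law[of K z]
  have c: "?c u v = (\<integral>\<^sup>+\<omega>. crossings (\<lambda>n. \<omega> n) u v \<partial>chain_law K z)" for u v
    by (simp add: expected_crossings_def)
  have upper: "?c u v \<le> ?g u * transition K u v + ?g v * transition K v u" for u v
    unfolding c by (rule expected_crossings_le[OF chain])
  have lower: "?g u * transition K u v \<le> ?c u v" for u v
    unfolding c by (rule expected_crossings_ge[OF chain])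
  show ?thesis
  proof (rule recurrent_network_if_vanishing_capacity[OF _ connected_transition_graph[OF irr]])
    show "network (transition_graph K) ?c"
      unfolding network_def
    proof (intro conjI allI ballI impI)
      show "wf_ugraph (transition_graph K)"
        by (auto simp: wf_ugraph_def transition_graph_def)
      show "?c u v = ?c v u" for u v
        unfolding expected_crossings_def by (subst crossings_commute) simp
      show "?c u v = 0" if "{u, v} \<notin> edges (transition_graph K)" for u v
      proof -
        have "pmf (K u) v + pmf (K v) u \<le> 0"
          using that by (force simp: transition_graph_def)
        then have "pmf (K u) v = 0" "pmf (K v) u = 0"
          using pmf_nonneg[of "K u" v] pmf_nonneg[of "K v" u] by linarith+
        then show ?thesis using upper[of u v] by simp
      qed
      show "vertex_weight ?c v < \<infinity>" for v
      proof -
        have "vertex_weight ?c v \<le> (\<integral>\<^sup>+w. ?g v * transition K v w + ?g w * transition K w v \<partial>count_space UNIV)"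
          unfolding vertex_weight_def by (intro nn_integral_mono upper)
        also have "\<dots> = ?g v + (\<integral>\<^sup>+w. ?g w * transition K w v \<partial>count_space UNIV)"
          by (simp add: nn_integral_add nn_integral_cmult nn_integral_transition)
        also have "\<dots> \<le> ?g v + ?g v"
          by (subst (3) green_eq) (intro add_left_mono, simp)
        also have "\<dots> < \<infinity>" using fin[of v] by simp
        finally show ?thesis .
      qed
    qed
    show "0 < vertex_weight ?c v" for v
    proof -
      obtain w where w: "w \<in> set_pmf (K v)" using set_pmf_not_empty[of "K v"] by blast
      have "0 < ?g v * transition K v w"
        using green_pos[OF irr, of z v] pmf_positive[OF w] by (simp add: ennreal_zero_less_mult_iff)
      also have "\<dots> \<le> ?c v w" by (rule lower)
      also have "\<dots> \<le> vertex_weight ?c v"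
        unfolding vertex_weight_def by (rule nn_integral_ge_point) simp
      finally show ?thesis .
    qed
    show "vanishing_capacity ?c v" for v
      using vanishing_capacity_expected_crossings[OF chain vanishing_capacity_green_flow[OF irr stat fin], of v]
      by (simp add: expected_crossings_def[abs_def])
  qed
qed

lemma connected_path_graph: "connected_ugraph (path_graph x)"
proof -
  let ?R = "{(u, v). {u, v} \<in> edges (path_graph x)}"
  have from_start: "(x 0, x n) \<in> ?R\<^sup>*" for n
  proof (induction n)
    case (Suc n)
    have "(x n, x (Suc n)) \<in> ?R" by (auto simp: path_graph_def)
    with Suc show ?case by (rule rtrancl_into_rtrancl)
  qed simp
  have "sym (?R\<^sup>*)" by (rule sym_rtrancl) (auto simp: sym_def insert_commute)
  then have "(x m, x n) \<in> ?R\<^sup>*" for m n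
    by (rule rtrancl_trans[OF symD[OF _ from_start] from_start])
  then show ?thesis by (auto simp: connected_ugraph_def path_graph_def)
qed

lemma crossings_ge_1: "{u, v} \<in> edges (path_graph x) \<Longrightarrow> 1 \<le> crossings x u v"
proof -
  assume "{u, v} \<in> edges (path_graph x)"
  then obtain n where "{x n, x (Suc n)} = {u, v}" by (auto simp: path_graph_def)
  then have "emeasure (count_space UNIV) {n} \<le> crossings x u v"
    unfolding crossings_def by (intro emeasure_mono) auto
  then show ?thesis by simp
qed

lemma network_path_graph:
  assumes fin: "\<And>v. finite {n. x n = v}"
  shows "network (path_graph x) (crossings x)"
  unfolding network_def
proof (intro conjI allI ballI impI)
  show "wf_ugraph (path_graph x)"
    by (auto simp: wf_ugraph_def path_graph_def)
  show "crossings x u v = crossings x v u" for u v by (rule crossings_commute)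
  show "crossings x u v = 0" if "{u, v} \<notin> edges (path_graph x)" for u v
  proof -
    have "{n. {x n, x (Suc n)} = {u, v}} = {}" using that by (auto simp: path_graph_def)
    then show ?thesis by (simp only: crossings_def emeasure_empty)
  qed
  show "vertex_weight (crossings x) v < \<infinity>" for v
  proof -
    let ?T = "{n. x n = v} \<union> {n. x (Suc n) = v}"
    let ?W = "x ` ?T \<union> (\<lambda>n. x (Suc n)) ` ?T"
    have "finite (Suc -` {n. x n = v})" by (intro finite_vimageI fin) simp
    then have T: "finite ?T" using fin[of v] by (simp add: vimage_def)
    have sub: "{n. {x n, x (Suc n)} = {v, w}} \<subseteq> ?T" for w by (auto simp: doubleton_eq_iff)
    have "crossings x v w < \<infinity>" for w
      unfolding crossings_def using finite_subset[OF sub T] by (simp add: emeasure_count_space_finite less_top[symmetric])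
    moreover have "crossings x v w = 0" if "w \<notin> ?W" for w
    proof -
      have "{n. {x n, x (Suc n)} = {v, w}} = {}"
        using that by (auto simp: doubleton_eq_iff)
      then show ?thesis by (simp only: crossings_def emeasure_empty)
    qed
    then have "vertex_weight (crossings x) v = (\<Sum>w\<in>?W. crossings x v w)"
      unfolding vertex_weight_def using T by (intro nn_integral_count_space') auto
    ultimately show ?thesis using T by simp
  qed
qed

lemma vertex_weight_pos_if_edges_heavy:
  assumes "\<And>u v. {u, v} \<in> edges (path_graph x) \<Longrightarrow> 1 \<le> c u v" and "v \<in> vertices (path_graph x)"
  shows "0 < vertex_weight c v"
proof -
  obtain n where n: "v = x n" using assms(2) by (auto simp: path_graph_def)
  have "1 \<le> c v (x (Suc n))"
    by (rule assms(1)) (auto simp: path_graph_def n)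
  also have "\<dots> \<le> vertex_weight c v"
    unfolding vertex_weight_def by (rule nn_integral_ge_point) simp
  finally show ?thesis by (rule less_le_trans[rotated]) simp
qed

text \<open>
  The unit weights of the simple random walk are bounded by the crossing numbers, so vanishing capacity is
  inherited: this is Rayleigh's monotonicity principle.
\<close>

lemma recurrent_trace:
  fixes x :: "nat \<Rightarrow> 'v::countable"
  assumes fin: "\<And>v. finite {n. x n = v}" and cap: "\<And>v. vanishing_capacity (crossings x) v"
  shows "recurrent_network (path_graph x) (crossings x)" and "recurrent_graph (path_graph x)"
proof -
  show "recurrent_network (path_graph x) (crossings x)"
    by (intro recurrent_network_if_vanishing_capacity network_path_graph fin cap connected_path_graph
        vertex_weight_pos_if_edges_heavy[OF crossings_ge_1])
  let ?c = "\<lambda>u v. if {u, v} \<in> edges (path_graph x) then 1 else 0 :: ennreal"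
  have le: "?c u v \<le> crossings x u v" for u v
    using crossings_ge_1[of u v x] by simp
  have weight: "vertex_weight ?c v \<le> vertex_weight (crossings x) v" for v
    unfolding vertex_weight_def by (intro nn_integral_mono le)
  have "network (path_graph x) ?c"
    using network_path_graph[OF fin] le_less_trans[OF weight]
    unfolding network_def by (auto simp: insert_commute)
  then show "recurrent_graph (path_graph x)"
    unfolding recurrent_graph_def
    by (intro recurrent_network_if_vanishing_capacity connected_path_graph vanishing_capacity_mono[OF cap le]
        vertex_weight_pos_if_edges_heavy[of x ?c]) auto
qed

theorem theorem1:
  fixes M :: "'w measure"
    and K :: "'v::countable \<Rightarrow> 'v pmf"
    and s :: 'v
    and X :: "nat \<Rightarrow> 'w \<Rightarrow> 'v"
  assumes "markov_chain M K s X"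
    and "irreducible_kernel K"
    and "transient_process M X"
    and "\<exists>\<pi>. stationary_measure K \<pi>"
  shows "(AE \<omega> in M. recurrent_graph (path_graph (\<lambda>n. X n \<omega>))) \<and>
         (AE \<omega> in M. recurrent_network (path_graph (\<lambda>n. X n \<omega>)) (crossings (\<lambda>n. X n \<omega>))) \<and>
         (\<forall>z. recurrent_network (transition_graph K) (expected_crossings K z))"
proof -
  note chain = assms(1) and irr = assms(2)
  obtain \<pi> where stat: "stationary_measure K \<pi>" using assms(4) by blast
  have "green (transition K) UNIV s s < \<infinity>"
    using recurrent_if_green_infinite[OF chain] assms(3)
    by (metis infinity_ennreal_def less_top transient_process_def)
  then have fin: "green (transition K) UNIV x y < \<infinity>" for x y
    by (rule green_finite_if_irreducible[OF irr])
  have "AE \<omega> in M. \<forall>v. emeasure (count_space UNIV) {n. X n \<omega> = v} \<noteq> \<infinity>"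
    unfolding AE_all_countable
  proof
    fix v
    have [measurable]: "(\<lambda>\<omega>. emeasure (count_space UNIV) {n. X n \<omega> = v}) \<in> borel_measurable M"
      by (rule visits_measurable[OF chain])
    show "AE \<omega> in M. emeasure (count_space UNIV) {n. X n \<omega> = v} \<noteq> \<infinity>"
      using expected_visits[OF chain, of v] fin[of s v] by (intro nn_integral_PInf_AE) auto
  qed
  moreover have "AE \<omega> in M. \<forall>t. vanishing_capacity (crossings (\<lambda>n. X n \<omega>)) t"
    unfolding AE_all_countable
    by (intro allI AE_vanishing_capacity_crossings[OF chain]
        vanishing_capacity_expected_crossings[OF chain] vanishing_capacity_green_flow[OF irr stat] fin)
  ultimately have "AE \<omega> in M. recurrent_network (path_graph (\<lambda>n. X n \<omega>)) (crossings (\<lambda>n. X n \<omega>)) \<and>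
      recurrent_graph (path_graph (\<lambda>n. X n \<omega>))"
  proof eventually_elim
    case (elim \<omega>)
    have "finite {n. X n \<omega> = v}" for v
      using elim(1) by (metis emeasure_count_space_infinite subset_UNIV)
    then show ?case using elim(2) recurrent_trace[of "\<lambda>n. X n \<omega>"] by blast
  qed
  then show ?thesis
    using recurrent_expected_crossings[OF irr stat fin] by (auto elim: eventually_mono)
qed

end
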